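(* Let $-A$ be the generator of a positive $C_0$-semigroup $(T(t))_{t\ge0}$ on a Banach lattice $X$ which is $p$-convex and $q$-concave for some $p\in[1,\infty)$ and $q\in[p,\infty)$. Then $\omega_{\frac1p-\frac1q}(T)\le s(-A)$.
   Context: Complex Banach lattice $X$. $X$ is $p$-convex if $\|(\sum_k|x_k|^p)^{1/p}\|\le C(\sum_k\|x_k\|^p)^{1/p}$ and $q$-concave if $(\sum_k\|x_k\|^q)^{1/q}\le C\|(\sum_k|x_k|^q)^{1/q}\|$ for all finite families. A semigroup is positive if each $T(t)$ maps the positive cone into itself. Let $\omega_0(T)$ be the exponential growth bound of $(T(t))$. Fix $\eta>\omega_0(T)$; for $\beta\ge0$ let $X_\beta:=D((\eta+A)^\beta)$ with the graph norm (fractional power of the sectorial operator $\eta+A$; independent of $\eta$ up to equivalent norms), $X_0=X$. For $x\in X$ let $\omega(x):=\inf\{\omega\in\mathbb R:\lim_{t\to\infty}\|e^{-\omega t}T(t)x\|=0\}$ and $\omega_\beta(T):=\sup\{\omega(x):x\in X_\beta\}$. $s(-A):=\sup\{\Re\lambda:\lambda\in\sigma(-A)\}$ is the spectral bound. *)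

theory Defs
  imports "HOL-Analysis.Analysis"
begin

class banach_lattice = banach + lattice + ordered_real_vector +
  assumes lattice_norm: "sup x (- x) \<le> sup y (- y) \<Longrightarrow> norm x \<le> norm y"

definition is_lub_of :: "'a::order set \<Rightarrow> 'a \<Rightarrow> bool" where
  "is_lub_of S y \<longleftrightarrow> (\<forall>s\<in>S. s \<le> y) \<and> (\<forall>z. (\<forall>s\<in>S. s \<le> z) \<longrightarrow> y \<le> z)"

definition dual_unit_ball :: "real \<Rightarrow> nat \<Rightarrow> (nat \<Rightarrow> real) set" where
  "dual_unit_ball p n =
     (if p = 1 then {a. \<forall>k<n. \<bar>a k\<bar> \<le> 1}
      else {a. (\<Sum>k<n. \<bar>a k\<bar> powr (p / (p - 1))) \<le> 1})"

text \<open>(sum_{k<n} |x_k|^p)^(1/p), computed in the Banach lattice as the supremum of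
  sum a_k x_k over the unit ball of l^{p'}.\<close>
definition lp_sum :: "real \<Rightarrow> nat \<Rightarrow> (nat \<Rightarrow> 'a::banach_lattice) \<Rightarrow> 'a" where
  "lp_sum p n x = (THE y. is_lub_of {\<Sum>k<n. a k *\<^sub>R x k | a. a \<in> dual_unit_ball p n} y)"

definition p_convex :: "real \<Rightarrow> 'a::banach_lattice itself \<Rightarrow> bool" where
  "p_convex p _ \<longleftrightarrow> (\<exists>C. \<forall>n. \<forall>x :: nat \<Rightarrow> 'a.
      norm (lp_sum p n x) \<le> C * (\<Sum>k<n. norm (x k) powr p) powr (1 / p))"

definition q_concave :: "real \<Rightarrow> 'a::banach_lattice itself \<Rightarrow> bool" where
  "q_concave q _ \<longleftrightarrow> (\<exists>C. \<forall>n. \<forall>x :: nat \<Rightarrow> 'a.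
      (\<Sum>k<n. norm (x k) powr q) powr (1 / q) \<le> C * norm (lp_sum q n x))"

definition c0_semigroup :: "(real \<Rightarrow> 'a::banach \<Rightarrow> 'a) \<Rightarrow> bool" where
  "c0_semigroup T \<longleftrightarrow>
     (\<forall>t\<ge>0. bounded_linear (T t)) \<and> T 0 = id \<and>
     (\<forall>s\<ge>0. \<forall>t\<ge>0. T (s + t) = T s \<circ> T t) \<and>
     (\<forall>x. ((\<lambda>t. T t x) \<longlongrightarrow> x) (at_right 0))"

definition positive_semigroup :: "(real \<Rightarrow> 'a::banach_lattice \<Rightarrow> 'a) \<Rightarrow> bool" where
  "positive_semigroup T \<longleftrightarrow> (\<forall>t\<ge>0. \<forall>x. 0 \<le> x \<longrightarrow> 0 \<le> T t x)"

definition gen_dom :: "(real \<Rightarrow> 'a::banach \<Rightarrow> 'a) \<Rightarrow> 'a set" where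
  "gen_dom T = {x. \<exists>y. ((\<lambda>h. (1 / h) *\<^sub>R (T h x - x)) \<longlongrightarrow> y) (at_right 0)}"

definition gen :: "(real \<Rightarrow> 'a::banach \<Rightarrow> 'a) \<Rightarrow> 'a \<Rightarrow> 'a" where
  "gen T x = Lim (at_right 0) (\<lambda>h. (1 / h) *\<^sub>R (T h x - x))"

text \<open>Resolvent set of -A = G on the complexification X + iX: the complex number
  a + ib lies in the resolvent set iff (a+ib) - G, acting on D(G) + i D(G), is a
  bijection onto X + iX with bounded inverse.\<close>
definition in_resolvent :: "(real \<Rightarrow> 'a::banach \<Rightarrow> 'a) \<Rightarrow> real \<Rightarrow> real \<Rightarrow> bool" where
  "in_resolvent T a b \<longleftrightarrow>
     bij_betw (\<lambda>(x, y). (a *\<^sub>R x - gen T x - b *\<^sub>R y, b *\<^sub>R x + a *\<^sub>R y - gen T y))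
              (gen_dom T \<times> gen_dom T) UNIV \<and>
     (\<exists>C. \<forall>x\<in>gen_dom T. \<forall>y\<in>gen_dom T.
        norm x + norm y \<le> C * (norm (a *\<^sub>R x - gen T x - b *\<^sub>R y)
                               + norm (b *\<^sub>R x + a *\<^sub>R y - gen T y)))"

text \<open>Spectral bound s(-A) (= -infinity for empty spectrum).\<close>
definition spectral_bound :: "(real \<Rightarrow> 'a::banach \<Rightarrow> 'a) \<Rightarrow> ereal" where
  "spectral_bound T = Sup {ereal a | a. \<exists>b. \<not> in_resolvent T a b}"

definition growth_bound :: "(real \<Rightarrow> 'a::banach \<Rightarrow> 'a) \<Rightarrow> ereal" where
  "growth_bound T = Inf (ereal ` {w. \<exists>M. \<forall>t\<ge>0. onorm (T t) \<le> M * exp (w * t)})"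

text \<open>X_beta = D((eta + A)^beta) = range of (eta + A)^(-beta), where for beta > 0
  (eta + A)^(-beta) x = 1/Gamma(beta) * int_0^infty t^(beta-1) e^(-eta t) T(t) x dt.\<close>
definition frac_dom :: "(real \<Rightarrow> 'a::banach \<Rightarrow> 'a) \<Rightarrow> real \<Rightarrow> real \<Rightarrow> 'a set" where
  "frac_dom T \<eta> \<beta> =
     (if \<beta> = 0 then UNIV
      else range (\<lambda>x. (1 / Gamma \<beta>) *\<^sub>R
                 integral {0..} (\<lambda>t. (t powr (\<beta> - 1) * exp (- \<eta> * t)) *\<^sub>R T t x)))"

definition orbit_bound :: "(real \<Rightarrow> 'a::banach \<Rightarrow> 'a) \<Rightarrow> 'a \<Rightarrow> ereal" where
  "orbit_bound T x =
     Inf (ereal ` {w. ((\<lambda>t. exp (- w * t) *\<^sub>R T t x) \<longlongrightarrow> 0) at_top})"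

definition omega_beta :: "(real \<Rightarrow> 'a::banach \<Rightarrow> 'a) \<Rightarrow> real \<Rightarrow> real \<Rightarrow> ereal" where
  "omega_beta T \<eta> \<beta> = Sup (orbit_bound T ` frac_dom T \<eta> \<beta>)"

end

theory Submission
  imports Defs "HOL-Real_Asymp.Real_Asymp"
begin

text \<open>
  Let \<open>a > s(-A)\<close> and \<open>S(t) = e\<^sup>-\<^sup>a\<^sup>t T(t)\<close>. Positivity of the resolvent propagates from large real
  points down to \<open>a\<close>, which gives \<open>\<integral>\<^sub>0\<^sup>N S(t) x dt \<le> R(a) x\<close> for all \<open>x \<ge> 0\<close> and all \<open>N\<close>.

  Cut time into windows of length \<open>h = 1/m\<close> and put \<open>y\<^sub>j = \<integral> S(t) y dt\<close> over the \<open>j\<close>-th window, where \<open>y \<ge> 0\<close>.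
  Writing \<open>y\<^sub>j\<close> as the mean of \<open>S(ih) y\<^sub>j\<^sub>-\<^sub>i\<close> over \<open>i < m\<close> and testing against the unit ball of \<open>\<ell>\<^sup>p\<^sup>'\<close>
  bounds the \<open>\<ell>\<^sup>p\<close>-sum of the \<open>y\<^sub>j\<close> by \<open>h R(a) F\<close>, where \<open>F\<close> is the \<open>\<ell>\<^sup>p\<close>-sum of the vectors \<open>S(ih) y\<close>, \<open>i < m\<close>.
  By \<open>p\<close>-convexity \<open>F\<close> has norm \<open>O(m\<^sup>1\<^sup>/\<^sup>p)\<close>; as the \<open>\<ell>\<^sup>q\<close>-sum is below the \<open>\<ell>\<^sup>p\<close>-sum, \<open>q\<close>-concavity shows that
  the average of \<open>S(s) y\<close> over \<open>s \<le> h\<close> has an orbit of norm \<open>O(m\<^sup>\<beta>)\<close>, \<open>\<beta> = 1/p - 1/q\<close>, uniformly in time.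

  If \<open>\<beta> = 0\<close>, let \<open>m\<close> tend to infinity. If \<open>\<beta> > 0\<close>, split the integral that defines the fractional power
  dyadically at \<open>0\<close>: the piece at scale \<open>2\<^sup>-\<^sup>j\<close> has weight \<open>2\<^sup>-\<^sup>j\<^sup>\<beta>\<close>, so at time \<open>t\<close> it contributes at most
  \<open>min(C, C 2\<^sup>-\<^sup>j\<^sup>\<beta> e\<^sup>w\<^sup>t)\<close>, and these bounds add up to \<open>O(1 + t)\<close>. An arbitrarily small change of \<open>a\<close>
  absorbs the linear growth.
\<close>

section \<open>Banach lattices\<close>

lemma lattice_norm_mono:
  fixes x y :: "'a::banach_lattice"
  assumes "0 \<le> x" "x \<le> y"
  shows "norm x \<le> norm y"
proof (rule lattice_norm)
  have "- x \<le> y" using assms by (meson le_minus_iff minus_le_iff neg_le_0_iff_le order_trans)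
  then show "sup x (- x) \<le> sup y (- y)" using assms by (simp add: le_supI1)
qed

lemma norm_le_of_bounds:
  fixes x u :: "'a::banach_lattice"
  assumes "x \<le> u" "- u \<le> x"
  shows "norm x \<le> norm u"
proof (rule lattice_norm)
  have "- x \<le> u" using assms by (simp add: minus_le_iff)
  then show "sup x (- x) \<le> sup u (- u)" using assms by (simp add: le_supI1)
qed

lemma pos_part_diff:
  fixes x :: "'a::banach_lattice"
  shows "x = sup x 0 - sup (- x) 0"
proof -
  have "sup x 0 \<le> sup (- x) 0 + x"
  proof (rule sup_least)
    show "x \<le> sup (- x) 0 + x" by simp
    show "0 \<le> sup (- x) 0 + x"
      using add_right_mono[of "- x" "sup (- x) 0" x] by simp
  qed
  moreover have "sup (- x) 0 \<le> sup x 0 - x"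
    by (rule sup_least) simp_all
  ultimately show ?thesis by (simp add: algebra_simps antisym)
qed

lemma norm_pos_part_le:
  fixes x :: "'a::banach_lattice"
  shows "norm (sup x 0) \<le> norm x"
proof (rule lattice_norm)
  have "- sup x 0 \<le> 0" by simp
  also have "0 \<le> sup x 0" by simp
  finally have *: "- sup x 0 \<le> sup x 0" .
  \<comment> \<open>The modulus \<open>sup x (- x)\<close> is nonnegative because twice it dominates
    \<open>x + (- x) = 0\<close>.\<close>
  have "sup x (- x) + sup x (- x) \<ge> x + - x" by (intro add_mono) simp_all
  then have "0 \<le> 2 *\<^sub>R sup x (- x)" by (simp add: scaleR_2)
  moreover have "sup x (- x) = (1/2) *\<^sub>R (2 *\<^sub>R sup x (- x))" by simp
  ultimately have "0 \<le> sup x (- x)" by (metis scaleR_nonneg_nonneg zero_le_divide_1_iff zero_le_numeral)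
  then show "sup (sup x 0) (- sup x 0) \<le> sup x (- x)"
    using * by (simp add: sup_absorb1)
qed

text \<open>If \<open>f n \<ge> 0\<close> then \<open>- l \<le> f n - l\<close>, so the negative
  part of the limit is dominated in norm by \<open>f n - l\<close> and vanishes.\<close>

lemma closed_positive_cone: "closed {x :: 'a::banach_lattice. 0 \<le> x}"
proof (unfold closed_sequential_limits, intro allI impI, elim conjE)
  fix f :: "nat \<Rightarrow> 'a" and l
  assume f: "\<forall>n. f n \<in> {x. 0 \<le> x}" and lim: "f \<longlonglongrightarrow> l"
  have "norm (sup (- l) 0) \<le> norm (f n - l)" for n
  proof -
    have "- l \<le> f n - l" using f by simp
    then have "sup (- l) 0 \<le> sup (f n - l) 0" by (meson order_refl sup_mono)
    then have "norm (sup (- l) 0) \<le> norm (sup (f n - l) 0)"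
      by (intro lattice_norm_mono) simp_all
    also have "\<dots> \<le> norm (f n - l)" by (rule norm_pos_part_le)
    finally show ?thesis .
  qed
  moreover have "(\<lambda>n. norm (f n - l)) \<longlonglongrightarrow> 0"
    using lim by (simp add: LIM_zero tendsto_norm_zero)
  ultimately have "norm (sup (- l) 0) \<le> 0"
    by (intro LIMSEQ_le_const) auto
  then have "- l \<le> 0" by (metis norm_le_zero_iff sup_ge1)
  then show "l \<in> {x. 0 \<le> x}" by simp
qed

lemma tendsto_le_lattice:
  fixes f g :: "'b \<Rightarrow> 'a::banach_lattice"
  assumes "F \<noteq> bot" "(f \<longlongrightarrow> x) F" "(g \<longlongrightarrow> y) F" "\<forall>\<^sub>F n in F. f n \<le> g n"
  shows "x \<le> y"
proof -
  have "y - x \<in> {x. 0 \<le> x}"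
    using assms by (intro Lim_in_closed_set[OF closed_positive_cone _ assms(1) tendsto_diff[OF assms(3,2)]]) auto
  then show ?thesis by simp
qed

text \<open>Gauge integrals are limits of tagged sums, each a combination of values of
  \<open>f\<close> with nonnegative weights, and the cone is closed.\<close>

lemma has_integral_nonneg_lattice:
  fixes f :: "real \<Rightarrow> 'a::banach_lattice"
  assumes f: "(f has_integral y) {a..b}" and pos: "\<And>t. t \<in> {a..b} \<Longrightarrow> 0 \<le> f t"
  shows "0 \<le> y"
proof -
  have "y \<in> closure {x. 0 \<le> x}"
  proof (unfold closure_approachable, intro allI impI)
    fix e :: real assume "e > 0"
    then obtain \<gamma> where g: "gauge \<gamma>" and D: "\<And>D. D tagged_division_of {a..b} \<Longrightarrow> \<gamma> fine D \<Longrightarrow>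
        norm (sum (\<lambda>(x,k). measure lborel k *\<^sub>R f x) D - y) < e"
      using f unfolding has_integral_real by metis
    obtain D where DD: "D tagged_division_of {a..b}" "\<gamma> fine D"
      using fine_division_exists_real[OF g] by blast
    have "0 \<le> sum (\<lambda>(x,k). measure lborel k *\<^sub>R f x) D"
    proof (rule sum_nonneg, clarify)
      fix x k assume "(x, k) \<in> D"
      then have "x \<in> {a..b}" using DD(1) by (auto dest: tag_in_interval)
      then show "0 \<le> measure lborel k *\<^sub>R f x" using pos by (simp add: scaleR_nonneg_nonneg)
    qed
    then show "\<exists>z\<in>{x. 0 \<le> x}. dist z y < e"
      using D[OF DD] by (auto simp: dist_norm)
  qed
  then show ?thesis by (simp add: closure_closed[OF closed_positive_cone])
qed

lemma integral_mono_lattice: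
  fixes f g :: "real \<Rightarrow> 'a::banach_lattice"
  assumes "f integrable_on {a..b}" "g integrable_on {a..b}" "\<And>t. t \<in> {a..b} \<Longrightarrow> f t \<le> g t"
  shows "integral {a..b} f \<le> integral {a..b} g"
  using has_integral_nonneg_lattice[OF has_integral_diff[OF integrable_integral[OF assms(2)]
        integrable_integral[OF assms(1)]]] assms(3) by simp

lemma integral_nonneg_lattice:
  fixes f :: "real \<Rightarrow> 'a::banach_lattice"
  assumes "f integrable_on {a..b}" "\<And>t. t \<in> {a..b} \<Longrightarrow> 0 \<le> f t"
  shows "0 \<le> integral {a..b} f"
  using has_integral_nonneg_lattice[OF integrable_integral[OF assms(1)]] assms(2) by simp

text \<open>Only finite suprema are available at first. Those of ever finer finite nets differ by
  multiples of \<open>u\<close> that tend to 0, hence are Cauchy in norm, and closedness of the cone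
  makes their limit the least upper bound.\<close>

lemma lub_exists_of_finite_nets:
  fixes S :: "'a::banach_lattice set"
  assumes u: "0 \<le> u"
    and net: "\<And>e. e > 0 \<Longrightarrow> \<exists>F. finite F \<and> F \<noteq> {} \<and> F \<subseteq> S \<and> (\<forall>z\<in>S. \<exists>z'\<in>F. z \<le> z' + e *\<^sub>R u)"
  shows "\<exists>y. is_lub_of S y"
proof -
  define e where "e k = 1 / real (Suc k)" for k
  have e: "e k > 0" for k by (simp add: e_def)
  have e0: "e \<longlonglongrightarrow> 0" unfolding e_def by (rule LIMSEQ_Suc[OF lim_1_over_n])
  obtain F where F: "\<And>k. finite (F k)" "\<And>k. F k \<noteq> {}" "\<And>k. F k \<subseteq> S"
      "\<And>k z. z \<in> S \<Longrightarrow> \<exists>z'\<in>F k. z \<le> z' + e k *\<^sub>R u"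
    using net[OF e] by metis
  define Y where "Y k = Sup_fin (F k)" for k
  have Y_ub: "Y k \<le> v" if "\<And>z. z \<in> S \<Longrightarrow> z \<le> v" for k v
    unfolding Y_def using F(1-3) that by (intro Sup_fin.boundedI) blast+
  have Y_lb: "z \<le> Y k + e k *\<^sub>R u" if z: "z \<in> S" for z k
  proof -
    obtain z' where z': "z' \<in> F k" "z \<le> z' + e k *\<^sub>R u" using F(4)[OF z] by blast
    have "z' \<le> Y k" unfolding Y_def by (intro Sup_fin.coboundedI F z')
    then have "z' + e k *\<^sub>R u \<le> Y k + e k *\<^sub>R u" by simp
    with z' show ?thesis by (meson order_trans)
  qed
  \<comment> \<open>\<open>Y j\<close> is a supremum of elements of \<open>S\<close>, while
    \<open>Y k + e k *\<^sub>R u\<close> bounds all of \<open>S\<close>; this works for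
    \<open>j\<close> and \<open>k\<close> in either order.\<close>
  have YY: "Y j - Y k \<le> e k *\<^sub>R u" for j k
    using Y_ub[OF Y_lb, of j k] by (simp add: algebra_simps)
  have mx: "norm (Y j - Y k) \<le> (e j + e k) * norm u" for j k
  proof -
    have "Y j - Y k \<le> (e j + e k) *\<^sub>R u"
      using YY[of j k] scaleR_right_mono[OF _ u, of "e k" "e j + e k"] e[of j] by (meson less_imp_le order_trans le_add_same_cancel2)
    moreover have "Y k - Y j \<le> (e j + e k) *\<^sub>R u"
      using YY[of k j] scaleR_right_mono[OF _ u, of "e j" "e j + e k"] e[of k] by (meson less_imp_le order_trans le_add_same_cancel1)
    ultimately have "norm (Y j - Y k) \<le> norm ((e j + e k) *\<^sub>R u)"
      by (intro norm_le_of_bounds) (simp_all add: minus_le_iff)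
    also have "\<dots> = (e j + e k) * norm u" using e[of j] e[of k] by simp
    finally show ?thesis .
  qed
  have "Cauchy Y"
  proof (rule metric_CauchyI)
    fix r :: real assume r: "r > 0"
    have "(\<lambda>k. e k * norm u) \<longlonglongrightarrow> 0" using tendsto_mult_left_zero[OF e0] .
    then obtain N where N: "\<And>k. k \<ge> N \<Longrightarrow> e k * norm u < r / 2"
      using order_tendstoD(2)[of _ 0 sequentially "r/2"] r unfolding eventually_sequentially
      by (metis half_gt_zero)
    show "\<exists>M. \<forall>m\<ge>M. \<forall>n\<ge>M. dist (Y m) (Y n) < r"
    proof (intro exI allI impI)
      fix m n assume "N \<le> m" "N \<le> n"
      then show "dist (Y m) (Y n) < r"
        using mx[of m n] N[of m] N[of n] by (simp add: dist_norm algebra_simps)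
    qed
  qed
  then obtain y where y: "Y \<longlonglongrightarrow> y" using Cauchy_convergent_iff convergent_def by blast
  have "is_lub_of S y" unfolding is_lub_of_def
  proof (intro conjI ballI allI impI)
    fix z assume "z \<in> S"
    have "(\<lambda>k. Y k + e k *\<^sub>R u) \<longlonglongrightarrow> y + 0 *\<^sub>R u" by (intro tendsto_intros y e0)
    then show "z \<le> y" using Y_lb[OF \<open>z \<in> S\<close>]
      by (intro tendsto_le_lattice[of sequentially "\<lambda>_. z" z "\<lambda>k. Y k + e k *\<^sub>R u" y]) auto
  next
    fix v assume "\<forall>s\<in>S. s \<le> v"
    then show "y \<le> v"
      by (intro tendsto_le_lattice[OF _ y tendsto_const] always_eventually allI Y_ub) auto
  qed
  then show ?thesis ..
qed

section \<open>Dual unit balls and existence of \<open>lp_sum\<close>\<close>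

lemma dual_unit_ball_abs_le:
  assumes "a \<in> dual_unit_ball p n" "1 \<le> p" "k < n"
  shows "\<bar>a k\<bar> \<le> 1"
proof (cases "p = 1")
  case True then show ?thesis using assms by (simp add: dual_unit_ball_def)
next
  case False
  then have p: "p > 1" using assms by simp
  have "\<bar>a k\<bar> powr (p / (p - 1)) \<le> (\<Sum>k<n. \<bar>a k\<bar> powr (p / (p - 1)))"
    using assms(3) by (intro member_le_sum) auto
  also have "\<dots> \<le> 1" using assms False by (simp add: dual_unit_ball_def)
  finally have *: "\<bar>a k\<bar> powr (p / (p - 1)) \<le> 1" .
  show ?thesis
  proof (rule ccontr)
    assume "\<not> \<bar>a k\<bar> \<le> 1"
    then have "\<bar>a k\<bar> powr (p / (p - 1)) > 1" using p by simp
    with * show False by simp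
  qed
qed

lemma zero_in_dual_unit_ball: "(\<lambda>_. 0) \<in> dual_unit_ball p n"
  by (simp add: dual_unit_ball_def)

text \<open>The conjugate exponent decreases in the exponent, and on coordinates of modulus at most
  1 a larger power is smaller. Thus any bound tested on the ball for \<open>p\<close> also bounds
  the sum for \<open>q\<close>.\<close>

lemma dual_unit_ball_antimono:
  assumes "1 \<le> p" "p \<le> q" "a \<in> dual_unit_ball q n"
  shows "a \<in> dual_unit_ball p n"
proof (cases "p = 1")
  case True
  then show ?thesis using dual_unit_ball_abs_le[OF assms(3)] assms by (simp add: dual_unit_ball_def)
next
  case False
  then have pq: "1 < p" "1 < q" using assms by auto
  have "q / (q - 1) \<le> p / (p - 1)" using pq assms by (simp add: field_simps)
  then have "\<bar>a k\<bar> powr (p / (p - 1)) \<le> \<bar>a k\<bar> powr (q / (q - 1))" if "k < n" for k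
    using dual_unit_ball_abs_le[OF assms(3) _ that] pq by (intro powr_mono') auto
  then have "(\<Sum>k<n. \<bar>a k\<bar> powr (p / (p - 1))) \<le> (\<Sum>k<n. \<bar>a k\<bar> powr (q / (q - 1)))"
    by (intro sum_mono) auto
  then show ?thesis using assms(3) pq by (simp add: dual_unit_ball_def)
qed

text \<open>Injectivity lets each coordinate of \<open>a\<close> be counted at most once. This will
  keep shifted and truncated weights inside the dual ball.\<close>

lemma dual_unit_ball_reindex:
  assumes "a \<in> dual_unit_ball p n" "inj_on f {i\<in>{..<m}. P i}" "\<And>i. i < m \<Longrightarrow> P i \<Longrightarrow> f i < n"
  shows "(\<lambda>i. if P i then a (f i) else 0) \<in> dual_unit_ball p m"
proof (cases "p = 1")
  case True
  then show ?thesis using assms by (auto simp: dual_unit_ball_def)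
next
  case False
  let ?g = "\<lambda>x. \<bar>x\<bar> powr (p / (p - 1))"
  have "(\<Sum>i<m. ?g (if P i then a (f i) else 0)) = (\<Sum>i | i \<in> {..<m} \<and> P i. ?g (a (f i)))"
    unfolding sum.inter_filter[OF finite_lessThan] by (rule sum.cong) auto
  also have "\<dots> = (\<Sum>k\<in>f ` {i\<in>{..<m}. P i}. ?g (a k))"
    by (subst sum.reindex[OF assms(2)]) simp
  also have "\<dots> \<le> (\<Sum>k<n. ?g (a k))"
    using assms(3) by (intro sum_mono2) auto
  also have "\<dots> \<le> 1" using assms(1) False by (simp add: dual_unit_ball_def)
  finally show ?thesis using False by (simp add: dual_unit_ball_def)
qed

text \<open>\<open>lp_sum\<close> is a definite description, so existence is the point. Coordinates
  in the dual ball lie between -1 and 1; rounding them to a grid of width \<open>1 / M\<close>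
  leaves finitely many cells, whose representatives form the nets for
  \<open>lub_exists_of_finite_nets\<close>.\<close>

lemma lp_sum_is_lub:
  fixes x :: "nat \<Rightarrow> 'a::banach_lattice"
  assumes p: "1 \<le> p"
  shows "is_lub_of {\<Sum>k<n. a k *\<^sub>R x k | a. a \<in> dual_unit_ball p n} (lp_sum p n x)"
proof -
  define S where "S = {\<Sum>k<n. a k *\<^sub>R x k | a. a \<in> dual_unit_ball p n}"
  \<comment> \<open>\<open>ab k\<close> is the modulus of \<open>x k\<close>; the sum
    \<open>u\<close> of these moduli measures the rounding error.\<close>
  define ab where "ab k = sup (x k) 0 + sup (- x k) 0" for k
  define u where "u = (\<Sum>k<n. ab k)"
  have ab0: "0 \<le> ab k" for k unfolding ab_def by (intro add_nonneg_nonneg) simp_all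
  have ab: "c *\<^sub>R x k \<le> d *\<^sub>R ab k" if "\<bar>c\<bar> \<le> d" for c d k
  proof -
    have "c *\<^sub>R x k = c *\<^sub>R sup (x k) 0 + (- c) *\<^sub>R sup (- x k) 0"
      by (subst (1) pos_part_diff) (simp add: scaleR_right_diff_distrib)
    also have "\<dots> \<le> d *\<^sub>R sup (x k) 0 + d *\<^sub>R sup (- x k) 0"
      using that by (intro add_mono scaleR_right_mono) auto
    finally show ?thesis by (simp add: ab_def scaleR_right_distrib)
  qed
  have u: "0 \<le> u" unfolding u_def by (intro sum_nonneg ab0)
  have "\<exists>y. is_lub_of S y"
  proof (rule lub_exists_of_finite_nets[OF u])
    fix e :: real assume e: "e > 0"
    let ?B = "dual_unit_ball p n"
    obtain M :: nat where M: "1 / e < M" using reals_Archimedean2 by blast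
    then have M0: "M > 0" using e by (metis gr_zeroI not_less_iff_gr_or_eq of_nat_0 order_less_trans zero_less_divide_1_iff)
    have Me: "1 / real M \<le> e" using M e M0 by (simp add: field_simps)
    \<comment> \<open>The grid cell of \<open>a\<close>. The dual ball leaves the coordinates from
      \<open>n\<close> on unconstrained, so \<open>restrict\<close> discards them and only finitely
      many cells occur.\<close>
    define c where "c a = restrict (\<lambda>k. \<lfloor>a k * M\<rfloor>) {..<n}" for a :: "nat \<Rightarrow> real"
    have "c ` ?B \<subseteq> PiE {..<n} (\<lambda>_. {- int M..int M})"
    proof (clarify, unfold c_def, rule restrict_PiE_iff[THEN iffD2], intro ballI)
      fix a k assume a: "a \<in> ?B" and k: "k \<in> {..<n}"
      have "\<bar>a k\<bar> \<le> 1" using dual_unit_ball_abs_le[OF a p] k by simp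
      then have "- real M \<le> a k * M \<and> a k * M \<le> real M"
        using mult_right_mono[of "a k" 1 "real M"] mult_right_mono[of "-1" "a k" "real M"] by auto
      then show "\<lfloor>a k * M\<rfloor> \<in> {- int M..int M}"
        by (simp add: le_floor_iff floor_le_iff)
    qed
    then have fin: "finite (c ` ?B)" by (rule finite_subset) (intro finite_PiE, auto)
    \<comment> \<open>\<open>D\<close> meets every occupied cell.\<close>
    then obtain D where D: "D \<subseteq> ?B" "finite D" "c ` D = c ` ?B"
      by (metis finite_subset_image order_refl)
    let ?v = "\<lambda>a. \<Sum>k<n. a k *\<^sub>R x k"
    show "\<exists>F. finite F \<and> F \<noteq> {} \<and> F \<subseteq> S \<and> (\<forall>z\<in>S. \<exists>z'\<in>F. z \<le> z' + e *\<^sub>R u)"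
    proof (intro exI conjI ballI)
      show "finite (?v ` D)" using D by simp
      show "?v ` D \<noteq> {}" using D zero_in_dual_unit_ball[of p n] by blast
      show "?v ` D \<subseteq> S" using D by (auto simp: S_def)
      fix z assume "z \<in> S"
      then obtain a where a: "a \<in> ?B" "z = ?v a" by (auto simp: S_def)
      then have "c a \<in> c ` D" using D(3) by simp
      then obtain b where b: "b \<in> D" "c b = c a" by force
      have "z - ?v b = (\<Sum>k<n. (a k - b k) *\<^sub>R x k)"
        by (simp add: a sum_subtractf scaleR_left_diff_distrib)
      also have "\<dots> \<le> (\<Sum>k<n. e *\<^sub>R ab k)"
      proof (rule sum_mono, rule ab)
        fix k assume k: "k \<in> {..<n}"
        have "c b k = c a k" by (simp only: b(2))
        then have "\<lfloor>b k * M\<rfloor> = \<lfloor>a k * M\<rfloor>" using k by (simp add: c_def)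
        then have "\<bar>a k * M - b k * M\<bar> \<le> 1" by linarith
        moreover have "\<bar>a k * M - b k * M\<bar> = \<bar>a k - b k\<bar> * M"
          by (metis abs_mult abs_of_nat left_diff_distrib)
        ultimately have "\<bar>a k - b k\<bar> * M \<le> 1" by simp
        then have "\<bar>a k - b k\<bar> \<le> 1 / M" using M0 by (simp add: field_simps)
        then show "\<bar>a k - b k\<bar> \<le> e" using Me by simp
      qed
      also have "\<dots> = e *\<^sub>R u" by (simp add: u_def scaleR_sum_right)
      finally show "\<exists>z'\<in>?v ` D. z \<le> z' + e *\<^sub>R u" using b by (auto simp: algebra_simps)
    qed
  qed
  then obtain y where y: "is_lub_of S y" ..
  have "is_lub_of S (THE y. is_lub_of S y)"
    by (rule theI[where P = "is_lub_of S", OF y]) (use y in \<open>auto simp: is_lub_of_def intro: antisym\<close>)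
  then show ?thesis by (simp add: lp_sum_def S_def)
qed

lemma lp_sum_upper:
  fixes x :: "nat \<Rightarrow> 'a::banach_lattice"
  assumes "1 \<le> p" "a \<in> dual_unit_ball p n"
  shows "(\<Sum>k<n. a k *\<^sub>R x k) \<le> lp_sum p n x"
  using lp_sum_is_lub[OF assms(1), of x n] assms(2) by (auto simp: is_lub_of_def)

lemma lp_sum_least:
  fixes x :: "nat \<Rightarrow> 'a::banach_lattice"
  assumes "1 \<le> p" "\<And>a. a \<in> dual_unit_ball p n \<Longrightarrow> (\<Sum>k<n. a k *\<^sub>R x k) \<le> z"
  shows "lp_sum p n x \<le> z"
  using lp_sum_is_lub[OF assms(1), of x n] assms(2) unfolding is_lub_of_def by blast

lemma lp_sum_nonneg:
  fixes x :: "nat \<Rightarrow> 'a::banach_lattice"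
  assumes "1 \<le> p"
  shows "0 \<le> lp_sum p n x"
  using lp_sum_upper[OF assms zero_in_dual_unit_ball, of x n] by simp

section \<open>Orbits and their integrals\<close>

text \<open>With \<open>1 \<le> M\<close> and \<open>0 \<le> w\<close> the bound
  \<open>M * exp (w * t)\<close> increases in \<open>t\<close>, so its value at the right end serves
  a whole time interval.\<close>

locale bounded_c0_semigroup =
  fixes S :: "real \<Rightarrow> 'a::banach \<Rightarrow> 'a" and M w :: real
  assumes bounded_linear_S: "0 \<le> t \<Longrightarrow> bounded_linear (S t)"
    and S0: "S 0 x = x"
    and S_add: "0 \<le> s \<Longrightarrow> 0 \<le> t \<Longrightarrow> S (s + t) x = S s (S t x)"
    and S_right: "((\<lambda>t. S t x) \<longlongrightarrow> x) (at_right 0)"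
    and M: "1 \<le> M" and w: "0 \<le> w"
    and norm_S_le: "0 \<le> t \<Longrightarrow> norm (S t x) \<le> M * exp (w * t) * norm x"
begin

lemma norm_S_le_upto: "0 \<le> t \<Longrightarrow> t \<le> r \<Longrightarrow> norm (S t x) \<le> M * exp (w * r) * norm x"
  using M w by (intro order_trans[OF norm_S_le] mult_right_mono mult_left_mono) (auto intro: mult_left_mono)

text \<open>Right continuity at 0 and local boundedness suffice: for \<open>u \<le> v\<close> the
  increment is \<open>S u (S (v - u) x - x)\<close>. Taking the earlier time as base point treats
  both sides of \<open>t\<close> alike.\<close>

lemma continuous_on_orbit: "continuous_on {0..} (\<lambda>t. S t x)"
proof (unfold continuous_on_iff, intro ballI allI impI)
  fix t e :: real assume t: "t \<in> {0..}" and e: "e > 0"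
  define B where "B = M * exp (w * (t + 1))"
  have B: "B > 0" using M by (simp add: B_def)
  have "\<forall>\<^sub>F s in at_right 0. dist (S s x) x < e / B"
    using S_right e B by (intro tendstoD) auto
  then obtain d where d: "d > 0" "\<And>s. 0 < s \<Longrightarrow> s < d \<Longrightarrow> dist (S s x) x < e / B"
    unfolding eventually_at_right_field by auto
  have key: "norm (S v x - S u x) < e" if "0 \<le> u" "u \<le> v" "v - u < d" "u \<le> t + 1" for u v
  proof (cases "u = v")
    case False
    have "S v x - S u x = S u (S (v - u) x - x)"
      using S_add[of u "v - u" x] that by (simp add: linear_diff[OF bounded_linear.linear[OF bounded_linear_S]])
    also have "norm \<dots> \<le> B * norm (S (v - u) x - x)"
      unfolding B_def by (rule norm_S_le_upto) (use that in auto)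
    also have "\<dots> < B * (e / B)"
      using d(2)[of "v - u"] that False B by (intro mult_strict_left_mono) (auto simp: dist_norm)
    finally show ?thesis using B by simp
  qed (use e in simp)
  show "\<exists>d>0. \<forall>x'\<in>{0..}. dist x' t < d \<longrightarrow> dist (S x' x) (S t x) < e"
  proof (intro exI[of _ "min d 1"] conjI ballI impI)
    fix s assume s: "s \<in> {0..}" "dist s t < min d 1"
    show "dist (S s x) (S t x) < e"
    proof (cases "s \<le> t")
      case True then show ?thesis using key[of s t] s t by (simp add: dist_norm norm_minus_commute)
    next
      case False then show ?thesis using key[of t s] s t by (simp add: dist_norm)
    qed
  qed (use d in auto)
qed

lemma continuous_on_orbit_interval: "0 \<le> a \<Longrightarrow> continuous_on {a..b} (\<lambda>t. S t x)"
  by (rule continuous_on_subset[OF continuous_on_orbit]) auto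

lemma orbit_integrable: "0 \<le> a \<Longrightarrow> (\<lambda>t. S t x) integrable_on {a..b}"
  by (intro integrable_continuous_real continuous_on_orbit_interval)

lemma S_integral:
  assumes "0 \<le> r" "0 \<le> a"
  shows "S r (integral {a..b} (\<lambda>t. S t x)) = integral {a + r..b + r} (\<lambda>t. S t x)"
proof -
  have "S r (integral {a..b} (\<lambda>t. S t x)) = integral {a..b} (S r \<circ> (\<lambda>t. S t x))"
    using assms by (intro integral_linear[symmetric] orbit_integrable bounded_linear_S)
  also have "\<dots> = integral {a..b} ((\<lambda>t. S t x) \<circ> (+) r)"
    using assms by (intro integral_cong) (auto simp: S_add)
  also have "((\<lambda>t. S t x) \<circ> (+) r has_integral integral {a + r..b + r} (\<lambda>t. S t x)) {a..b}"
    using has_integral_shift_cbox_iff[of "\<lambda>t. S t x" r "integral {a + r..b + r} (\<lambda>t. S t x)" a b]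
      integrable_integral[OF orbit_integrable[of "a + r" x "b + r"]] assms by simp
  then have "integral {a..b} ((\<lambda>t. S t x) \<circ> (+) r) = integral {a + r..b + r} (\<lambda>t. S t x)"
    by (rule integral_unique)
  finally show ?thesis .
qed

lemma S_commute: "0 \<le> s \<Longrightarrow> 0 \<le> t \<Longrightarrow> S s (S t x) = S t (S s x)"
  using S_add[of s t x] S_add[of t s x] by (simp add: add.commute)

lemma linear_integral:
  assumes "0 \<le> a"
  shows "linear (\<lambda>x. integral {a..b} (\<lambda>t. S t x))"
proof (rule linearI)
  fix x y
  have "integral {a..b} (\<lambda>t. S t (x + y)) = integral {a..b} (\<lambda>t. S t x + S t y)"
    using assms by (intro integral_cong) (simp add: linear_add[OF bounded_linear.linear[OF bounded_linear_S]])
  then show "integral {a..b} (\<lambda>t. S t (x + y)) = integral {a..b} (\<lambda>t. S t x) + integral {a..b} (\<lambda>t. S t y)"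
    using assms by (simp add: integral_add orbit_integrable)
next
  fix c x
  have "integral {a..b} (\<lambda>t. S t (c *\<^sub>R x)) = integral {a..b} (\<lambda>t. c *\<^sub>R S t x)"
    using assms by (intro integral_cong) (simp add: linear_scale[OF bounded_linear.linear[OF bounded_linear_S]])
  then show "integral {a..b} (\<lambda>t. S t (c *\<^sub>R x)) = c *\<^sub>R integral {a..b} (\<lambda>t. S t x)"
    by simp
qed

lemma integral_S:
  assumes "0 \<le> r" "0 \<le> a"
  shows "integral {a..b} (\<lambda>t. S t (S r x)) = S r (integral {a..b} (\<lambda>t. S t x))"
proof -
  have "S r (integral {a..b} (\<lambda>t. S t x)) = integral {a..b} (S r \<circ> (\<lambda>t. S t x))"
    using assms by (intro integral_linear[symmetric] orbit_integrable bounded_linear_S)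
  also have "\<dots> = integral {a..b} (\<lambda>t. S t (S r x))"
    using assms by (intro integral_cong) (auto simp: S_commute)
  finally show ?thesis ..
qed

lemma integral_concat: "0 \<le> a \<Longrightarrow> a \<le> b \<Longrightarrow> b \<le> c \<Longrightarrow>
   integral {a..b} (\<lambda>t. S t x) + integral {b..c} (\<lambda>t. S t x) = integral {a..c} (\<lambda>t. S t x)"
  by (rule Henstock_Kurzweil_Integration.integral_combine) (auto intro: orbit_integrable)

lemma norm_integral_le:
  assumes "0 \<le> a" "a \<le> b"
  shows "norm (integral {a..b} (\<lambda>t. S t x)) \<le> M * exp (w * b) * norm x * (b - a)"
  using assms by (intro integral_bound continuous_on_orbit_interval) (auto intro: norm_S_le_upto)

lemma average_tendsto: "((\<lambda>h. (1 / h) *\<^sub>R integral {0..h} (\<lambda>t. S t x)) \<longlongrightarrow> x) (at_right 0)"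
proof (rule tendstoI)
  fix e :: real assume e: "e > 0"
  then have "\<forall>\<^sub>F s in at_right 0. dist (S s x) x < e / 2"
    using S_right by (intro tendstoD) auto
  then obtain d where d: "d > 0" "\<And>s. 0 < s \<Longrightarrow> s < d \<Longrightarrow> dist (S s x) x < e / 2"
    unfolding eventually_at_right_field by auto
  show "\<forall>\<^sub>F h in at_right 0. dist ((1 / h) *\<^sub>R integral {0..h} (\<lambda>t. S t x)) x < e"
    unfolding eventually_at_right_field
  proof (intro exI[of _ d] conjI d allI impI)
    fix h assume h: "0 < h" "h < d"
    have "norm (integral {0..h} (\<lambda>t. S t x - x)) \<le> e / 2 * (h - 0)"
    proof (rule integral_bound)
      fix t assume "t \<in> {0..h}"
      then show "norm (S t x - x) \<le> e / 2"
        using d(2)[of t] h e S0 by (cases "t = 0") (auto simp: dist_norm)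
    qed (use h in \<open>auto intro!: continuous_intros continuous_on_orbit_interval\<close>)
    also have "integral {0..h} (\<lambda>t. S t x - x) = integral {0..h} (\<lambda>t. S t x) - h *\<^sub>R x"
      using h by (subst integral_diff) (auto intro: orbit_integrable)
    also have "\<dots> = h *\<^sub>R ((1 / h) *\<^sub>R integral {0..h} (\<lambda>t. S t x) - x)"
      using h by (simp add: scaleR_right_diff_distrib)
    finally have "h * norm ((1 / h) *\<^sub>R integral {0..h} (\<lambda>t. S t x) - x) \<le> h * (e / 2)"
      unfolding norm_scaleR using h by (simp add: mult.commute)
    then have "norm ((1 / h) *\<^sub>R integral {0..h} (\<lambda>t. S t x) - x) \<le> e / 2"
      by (rule mult_left_le_imp_le) (use h in simp)
    then show "dist ((1 / h) *\<^sub>R integral {0..h} (\<lambda>t. S t x)) x < e"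
      using e by (simp add: dist_norm)
  qed
qed

text \<open>The integral operator up to \<open>N\<close> is applied to the difference quotient. The
  overlapping parts of the two integrals cancel, leaving the mean over a window at \<open>N\<close>
  minus the mean over a window at 0; both converge by \<open>average_tendsto\<close>.\<close>

lemma integral_generator:
  assumes lim: "((\<lambda>h. (1 / h) *\<^sub>R (S h u - u)) \<longlongrightarrow> g) (at_right 0)" and N: "0 \<le> N"
  shows "integral {0..N} (\<lambda>t. S t g) = S N u - u"
proof -
  let ?I = "\<lambda>x. integral {0..N} (\<lambda>t. S t x)"
  let ?A = "\<lambda>h. (1 / h) *\<^sub>R integral {0..h} (\<lambda>t. S t u)"
  have "bounded_linear ?I"
  proof (rule bounded_linear_intro)
    show "norm (?I x) \<le> norm x * (M * exp (w * N) * N)" for x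
      using norm_integral_le[of 0 N x] N by (simp add: algebra_simps)
  qed (use linear_add[OF linear_integral] linear_scale[OF linear_integral] in auto)
  then have lim1: "((\<lambda>h. ?I ((1 / h) *\<^sub>R (S h u - u))) \<longlongrightarrow> ?I g) (at_right 0)"
    using lim by (rule bounded_linear.tendsto)
  have lim2: "((\<lambda>h. S N (?A h) - ?A h) \<longlongrightarrow> S N u - u) (at_right 0)"
    by (intro tendsto_diff average_tendsto bounded_linear.tendsto[OF bounded_linear_S[OF N]])
  have "?I ((1 / h) *\<^sub>R (S h u - u)) = S N (?A h) - ?A h" if h: "0 < h" for h
  proof -
    have "?I ((1 / h) *\<^sub>R (S h u - u)) = (1 / h) *\<^sub>R (?I (S h u) - ?I u)"
      by (simp only: linear_scale[OF linear_integral[OF order_refl]] linear_diff[OF linear_integral[OF order_refl]])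
    also have "?I (S h u) = integral {h..N + h} (\<lambda>t. S t u)"
      using h N by (simp add: integral_S S_integral)
    also have "\<dots> - ?I u = integral {N..N + h} (\<lambda>t. S t u) - integral {0..h} (\<lambda>t. S t u)"
      using integral_concat[of 0 h "N + h" u] integral_concat[of 0 N "N + h" u] h N
      by (simp add: algebra_simps)
    also have "integral {N..N + h} (\<lambda>t. S t u) = S N (integral {0..h} (\<lambda>t. S t u))"
      using h N by (simp add: S_integral add.commute)
    finally show ?thesis
      by (simp add: scaleR_right_diff_distrib linear_scale[OF bounded_linear.linear[OF bounded_linear_S[OF N]]])
  qed
  then have "\<forall>\<^sub>F h in at_right 0. ?I ((1 / h) *\<^sub>R (S h u - u)) = S N (?A h) - ?A h"
    by (auto simp: eventually_at_right_field intro: exI[of _ 1])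
  then show ?thesis
    by (intro tendsto_unique[OF trivial_limit_at_right_real Lim_transform_eventually[OF lim1] lim2])
qed

end

section \<open>Averages over a single scale\<close>

text \<open>The element \<open>u\<close> stands for the resolvent image \<open>R(a) x\<close>, and
  \<open>K\<close> for a bound on the norm of the resolvent at \<open>a\<close>. Only domination of
  the truncated integrals is recorded.\<close>

locale positive_potential_semigroup = bounded_c0_semigroup S M w
  for S :: "real \<Rightarrow> 'a::banach_lattice \<Rightarrow> 'a" and M w +
  fixes K :: real
  assumes pos: "0 \<le> t \<Longrightarrow> 0 \<le> x \<Longrightarrow> 0 \<le> S t x"
    and K: "0 \<le> K"
    and potential: "0 \<le> x \<Longrightarrow> \<exists>u. norm u \<le> K * norm x \<and> (\<forall>N\<ge>0. integral {0..N} (\<lambda>t. S t x) \<le> u)"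
begin

lemma S_mono:
  assumes "0 \<le> t" "x \<le> y" shows "S t x \<le> S t y"
  using pos[OF assms(1), of "y - x"] assms(2) by (simp add: linear_diff[OF bounded_linear.linear[OF bounded_linear_S[OF assms(1)]]])

lemma orbit_integral_nonneg: "0 \<le> a \<Longrightarrow> 0 \<le> x \<Longrightarrow> 0 \<le> integral {a..b} (\<lambda>t. S t x)"
  by (intro integral_nonneg_lattice orbit_integrable) (auto intro: pos)

lemma orbit_integral_mono: "0 \<le> a \<Longrightarrow> x \<le> y \<Longrightarrow> integral {a..b} (\<lambda>t. S t x) \<le> integral {a..b} (\<lambda>t. S t y)"
  by (intro integral_mono_lattice orbit_integrable) (auto intro: S_mono)

lemma integral_le_from_zero:
  assumes "0 \<le> a" "a \<le> b" "0 \<le> x"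
  shows "integral {a..b} (\<lambda>t. S t x) \<le> integral {0..b} (\<lambda>t. S t x)"
  using integral_concat[of 0 a b x] orbit_integral_nonneg[of 0 x a] assms
  by (metis add_increasing order_refl)

lemma sum_integral:
  assumes "0 \<le> c" "0 \<le> h"
  shows "(\<Sum>l<n. integral {c + real l * h..c + real l * h + h} (\<lambda>t. S t x))
           = integral {c..c + real n * h} (\<lambda>t. S t x)"
proof (induction n)
  case (Suc n)
  have "integral {c..c + real n * h} (\<lambda>t. S t x) + integral {c + real n * h..c + real n * h + h} (\<lambda>t. S t x)
    = integral {c..c + real n * h + h} (\<lambda>t. S t x)"
    by (rule integral_concat) (use assms in auto)
  then show ?case using Suc by (simp add: algebra_simps)
qed simp

text \<open>The window starting at \<open>N + 1 + k/m\<close> equals, for every \<open>i < m\<close>, the \<open>l\<close>-th window after time \<open>N\<close>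
  applied to \<open>S (i/m) y\<close>, where \<open>l = m + k - i\<close>. Averaging over \<open>i\<close> and collecting the terms of equal \<open>l\<close>
  turns the weights into shifted truncations of \<open>a\<close>, which stay in the dual ball.\<close>
lemma weighted_windows_le:
  fixes m N :: nat
  assumes m: "1 \<le> m" and p: "1 \<le> p" and y: "0 \<le> y" and a: "a \<in> dual_unit_ball p m"
    and F: "F = lp_sum p m (\<lambda>i. S (real i / m) y)"
    and u: "\<And>N. 0 \<le> N \<Longrightarrow> integral {0..N} (\<lambda>t. S t F) \<le> u"
  shows "(\<Sum>k<m. a k *\<^sub>R S (real (Suc N) + real k / m) (integral {0..1/m} (\<lambda>t. S t y))) \<le> (1 / m) *\<^sub>R u"
proof -
  define h where "h = 1 / real m"
  have h: "0 < h" "real m * h = 1" "\<And>i. real i / m = real i * h" using m by (auto simp: h_def)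
  define V where "V z = integral {0..h} (\<lambda>t. S t z)" for z
  have linV: "linear V" unfolding V_def by (rule linear_integral) simp
  note linS = bounded_linear.linear[OF bounded_linear_S]
  define g where "g l i = S (real N + real l * h) (V (S (real i * h) y))" for l i :: nat
  define b where "b l i = (if m \<le> l + i \<and> l + i < 2 * m then a (l + i - m) else 0)" for l i :: nat
  have g: "g (m + k - i) i = S (real (Suc N) + real k * h) (V y)" if "i < m" "k < m" for i k
  proof -
    have "V (S (real i * h) y) = S (real i * h) (V y)"
      unfolding V_def using h by (intro integral_S) auto
    then have "g (m + k - i) i = S (real N + real (m + k - i) * h + real i * h) (V y)"
      unfolding g_def using h by (subst S_add) auto
    also have "real N + real (m + k - i) * h + real i * h = real (Suc N) + real k * h"
      using that h by (simp add: of_nat_diff algebra_simps)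
    finally show ?thesis .
  qed
  \<comment> \<open>For \<open>i, k < m\<close> the index \<open>m + k - i\<close> lies between 1
    and \<open>2 * m - 1\<close>. The natural subtraction is therefore exact, and rows below
    \<open>2 * m\<close> suffice.\<close>
  have inner: "(\<Sum>k<m. a k *\<^sub>R g (m + k - i) i) = (\<Sum>l<2*m. b l i *\<^sub>R g l i)" if i: "i < m" for i
  proof -
    have "(\<Sum>k<m. a k *\<^sub>R g (m + k - i) i) = (\<Sum>l | l \<in> {..<2*m} \<and> m \<le> l + i \<and> l + i < 2 * m. a (l + i - m) *\<^sub>R g l i)"
      by (rule sum.reindex_bij_witness[of _ "\<lambda>l. l + i - m" "\<lambda>k. m + k - i"]) (use i in auto)
    also have "\<dots> = (\<Sum>l<2*m. b l i *\<^sub>R g l i)"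
      unfolding sum.inter_filter[OF finite_lessThan] by (rule sum.cong) (auto simp: b_def)
    finally show ?thesis .
  qed
  have row: "(\<Sum>i<m. b l i *\<^sub>R g l i) \<le> integral {real N + real l * h..real N + real l * h + h} (\<lambda>t. S t F)" for l
  proof -
    have "b l \<in> dual_unit_ball p m"
      unfolding b_def by (rule dual_unit_ball_reindex[OF a]) (auto simp: inj_on_def)
    then have le: "(\<Sum>i<m. b l i *\<^sub>R S (real i * h) y) \<le> F"
      unfolding F h(3) by (rule lp_sum_upper[OF p])
    have t: "0 \<le> real N + real l * h" using h by simp
    have "(\<Sum>i<m. b l i *\<^sub>R g l i) = S (real N + real l * h) (V (\<Sum>i<m. b l i *\<^sub>R S (real i * h) y))"
      unfolding g_def by (simp add: linear_sum[OF linV] linear_scale[OF linV] linear_sum[OF linS[OF t]] linear_scale[OF linS[OF t]])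
    also have "\<dots> \<le> S (real N + real l * h) (V F)"
      unfolding V_def by (intro S_mono t orbit_integral_mono le) simp
    also have "\<dots> = integral {real N + real l * h..real N + real l * h + h} (\<lambda>t. S t F)"
      unfolding V_def using t by (simp add: S_integral add.commute)
    finally show ?thesis .
  qed
  have hm: "h * (real m * c) = c" for c
    using h(2) by (metis mult.assoc mult.commute mult_1)
  \<comment> \<open>The inner sum consists of \<open>m\<close> copies of one vector, which the
    factor \<open>h = 1 / m\<close> turns into their mean.\<close>
  have "(\<Sum>k<m. a k *\<^sub>R S (real (Suc N) + real k * h) (V y)) = h *\<^sub>R (\<Sum>k<m. \<Sum>i<m. a k *\<^sub>R g (m + k - i) i)"
    by (simp add: g scaleR_sum_right sum_constant_scaleR h hm)
  also have "\<dots> = h *\<^sub>R (\<Sum>l<2*m. \<Sum>i<m. b l i *\<^sub>R g l i)"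
    by (subst sum.swap, subst (2) sum.swap) (simp add: inner)
  also have "\<dots> \<le> h *\<^sub>R (\<Sum>l<2*m. integral {real N + real l * h..real N + real l * h + h} (\<lambda>t. S t F))"
    using h by (intro scaleR_left_mono sum_mono row) auto
  also have "\<dots> = h *\<^sub>R integral {real N..real N + real (2 * m) * h} (\<lambda>t. S t F)"
    using h by (subst sum_integral) auto
  \<comment> \<open>Since \<open>F \<ge> 0\<close>, starting the integral at 0 only enlarges it; the
    bound \<open>u\<close> then no longer depends on \<open>N\<close>.\<close>
  also have "\<dots> \<le> h *\<^sub>R integral {0..real N + real (2 * m) * h} (\<lambda>t. S t F)"
    using h F lp_sum_nonneg[OF p] by (intro scaleR_left_mono integral_le_from_zero) auto
  also have "\<dots> \<le> h *\<^sub>R u"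
    using h by (intro scaleR_left_mono u) auto
  finally show ?thesis by (simp add: h_def V_def)
qed

text \<open>Convexity gives \<open>norm F\<close> of order \<open>m powr (1 / p)\<close>; concavity
  is applied to the \<open>m\<close> windows between times \<open>N + 1\<close> and
  \<open>N + 2\<close>. Each of them flows to time \<open>N + 2\<close> within one unit, so all
  their norms dominate a multiple of one and the same norm. This yields a factor
  \<open>m powr (1 / q)\<close> on the left.\<close>

lemma average_bound:
  assumes p: "1 \<le> p" and q: "p \<le> q"
    and cvx: "p_convex p TYPE('a)" and ccv: "q_concave q TYPE('a)"
  shows "\<exists>C\<ge>0. \<forall>m\<ge>1. \<forall>N. \<forall>y\<ge>0. norm (S (real N + 2) (real m *\<^sub>R integral {0..1/m} (\<lambda>t. S t y)))
            \<le> C * real m powr (1 / p - 1 / q) * norm y"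
proof -
  \<comment> \<open>The definitions do not fix the sign of the constants, so absolute values are
    used from here on.\<close>
  obtain C1' where "\<And>n (x::nat \<Rightarrow> 'a). norm (lp_sum p n x) \<le> C1' * (\<Sum>k<n. norm (x k) powr p) powr (1 / p)"
    using cvx unfolding p_convex_def by blast
  then have C1: "norm (lp_sum p n x) \<le> \<bar>C1'\<bar> * (\<Sum>k<n. norm (x k) powr p) powr (1 / p)" for n and x :: "nat \<Rightarrow> 'a"
    by (rule order_trans) (intro mult_right_mono, auto)
  obtain C2' where "\<And>n (x::nat \<Rightarrow> 'a). (\<Sum>k<n. norm (x k) powr q) powr (1 / q) \<le> C2' * norm (lp_sum q n x)"
    using ccv unfolding q_concave_def by blast
  then have C2: "(\<Sum>k<n. norm (x k) powr q) powr (1 / q) \<le> \<bar>C2'\<bar> * norm (lp_sum q n x)" for n and x :: "nat \<Rightarrow> 'a"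
    by (rule order_trans) (intro mult_right_mono, auto)
  define B where "B = M * exp w"
  have B: "B > 0" using M by (simp add: B_def)
  have B1: "norm (S t x) \<le> B * norm x" if "0 \<le> t" "t \<le> 1" for t x
    using norm_S_le_upto[OF that, of x] by (simp add: B_def)
  define C where "C = B * \<bar>C2'\<bar> * K * \<bar>C1'\<bar> * B"
  have C: "C \<ge> 0" using B K by (simp add: C_def)
  have "norm (S (real N + 2) (real m *\<^sub>R integral {0..1/m} (\<lambda>t. S t y))) \<le> C * real m powr (1 / p - 1 / q) * norm y"
    if m: "1 \<le> m" and y: "0 \<le> y" for m N :: nat and y
  proof -
    define F where "F = lp_sum p m (\<lambda>i. S (real i / m) y)"
    define v where "v = integral {0..1/m} (\<lambda>t. S t y)"
    define x where "x k = S (real (Suc N) + real k / m) v" for k :: nat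
    have F0: "0 \<le> F" unfolding F_def by (rule lp_sum_nonneg[OF p])
    have m0: "real m > 0" using m by simp
    obtain u where u: "norm u \<le> K * norm F" "\<And>N. N \<ge> 0 \<Longrightarrow> integral {0..N} (\<lambda>t. S t F) \<le> u"
      using potential[OF F0] by blast
    have "(\<Sum>i<m. norm (S (real i / m) y) powr p) \<le> (\<Sum>i<m. (B * norm y) powr p)"
      using p m by (intro sum_mono powr_mono2 B1) auto
    also have "\<dots> = real m * (B * norm y) powr p" by simp
    finally have "(\<Sum>i<m. norm (S (real i / m) y) powr p) powr (1 / p) \<le> (real m * (B * norm y) powr p) powr (1 / p)"
      using p by (intro powr_mono2) (auto intro: sum_nonneg)
    also have "\<dots> = real m powr (1 / p) * (B * norm y)"
      using p B by (simp add: powr_mult powr_powr)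
    finally have normF: "norm F \<le> \<bar>C1'\<bar> * (real m powr (1 / p) * (B * norm y))"
      unfolding F_def by (intro order_trans[OF C1] mult_left_mono) auto
    \<comment> \<open>Weights from the ball for \<open>q\<close> lie in the ball for
      \<open>p\<close>, where the window estimate applies.\<close>
    have "lp_sum q m x \<le> (1 / m) *\<^sub>R u"
      unfolding x_def v_def
      by (intro lp_sum_least weighted_windows_le[OF m p y _ F_def u(2)] dual_unit_ball_antimono[OF p q])
        (use p q in auto)
    then have "norm (lp_sum q m x) \<le> norm ((1 / real m) *\<^sub>R u)"
      using p q by (intro lattice_norm_mono lp_sum_nonneg) auto
    also have "\<dots> \<le> (1 / m) * (K * (\<bar>C1'\<bar> * (real m powr (1 / p) * (B * norm y))))"
      using u(1) mult_left_mono[OF normF K] m0 by (simp add: divide_right_mono)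
    finally have up: "(\<Sum>k<m. norm (x k) powr q) powr (1 / q) \<le>
        \<bar>C2'\<bar> * ((1 / m) * (K * (\<bar>C1'\<bar> * (real m powr (1 / p) * (B * norm y)))))"
      by (intro order_trans[OF C2] mult_left_mono) auto
    \<comment> \<open>\<open>z\<close> is a common lower bound for all \<open>norm (x k)\<close>;
      dividing by \<open>B\<close> pays for the flow of length at most 1 up to time
      \<open>N + 2\<close>.\<close>
    define z where "z = norm (S (real N + 2) v) / B"
    have z0: "0 \<le> z" using B by (simp add: z_def)
    have z: "z \<le> norm (x k)" if k: "k < m" for k
    proof -
      have "S (real N + 2) v = S (1 - real k / m) (x k)"
        unfolding x_def using k m0 by (subst S_add[symmetric]) (auto simp: add.commute)
      also have "norm \<dots> \<le> B * norm (x k)"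
        using k m0 by (intro B1) auto
      finally show ?thesis using B by (simp add: z_def field_simps)
    qed
    have "real m * z powr q = (\<Sum>k<m. z powr q)" by simp
    also have "\<dots> \<le> (\<Sum>k<m. norm (x k) powr q)"
      using p q z z0 by (intro sum_mono powr_mono2) auto
    finally have "(real m * z powr q) powr (1 / q) \<le> (\<Sum>k<m. norm (x k) powr q) powr (1 / q)"
      using p q by (intro powr_mono2) auto
    also have "(real m * z powr q) powr (1 / q) = real m powr (1 / q) * z"
      using p q z0 by (simp add: powr_mult powr_powr)
    finally have "real m powr (1 / q) * z \<le> \<bar>C2'\<bar> * ((1 / m) * (K * (\<bar>C1'\<bar> * (real m powr (1 / p) * (B * norm y)))))"
      using up by linarith
    \<comment> \<open>Multiplication by \<open>m\<close> passes from the integral over the window to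
      its mean and cancels the gain \<open>1 / m\<close> on the right.\<close>
    then have "B * (real m * (real m powr (1 / q) * z)) \<le> B * (real m * (\<bar>C2'\<bar> * ((1 / m) * (K * (\<bar>C1'\<bar> * (real m powr (1 / p) * (B * norm y)))))))"
      using B m0 by (intro mult_left_mono) auto
    then have "real m powr (1 / q) * (real m * norm (S (real N + 2) v)) \<le> C * real m powr (1 / p) * norm y"
      using B m0 by (simp add: z_def C_def mult_ac)
    moreover have "real m powr (1 / q) > 0" using m0 by simp
    ultimately have "real m * norm (S (real N + 2) v) \<le> C * real m powr (1 / p) * norm y / real m powr (1 / q)"
      by (simp add: pos_le_divide_eq mult.commute)
    moreover have "norm (S (real N + 2) (real m *\<^sub>R v)) = real m * norm (S (real N + 2) v)"
      by (simp add: linear_scale[OF bounded_linear.linear[OF bounded_linear_S]])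
    ultimately show ?thesis by (simp add: v_def powr_diff)
  qed
  then show ?thesis using C by blast
qed

end

section \<open>Dyadic decomposition of the fractional power\<close>

text \<open>With \<open>r ^ k0 < exp (- w)\<close>, the first \<open>k0 * N\<close> terms are
  bounded by \<open>C\<close> each, a total linear in \<open>N\<close>. Beyond that index the power
  of \<open>r\<close> has absorbed \<open>exp (w * N)\<close>, and a geometric series
  remains.\<close>

lemma sum_min_geometric_le_linear:
  fixes r C E w :: real
  assumes r: "0 < r" "r < 1" and C: "0 \<le> C" and E: "0 \<le> E"
  shows "\<exists>A\<ge>0. \<forall>(N::nat) n. (\<Sum>j<n. min C (r ^ j * (E * exp (w * N)))) \<le> A * (1 + real N)"
proof -
  obtain k0 where k0: "r ^ k0 < exp (- w)"
    using real_arch_pow_inv[of "exp (- w)" r] r by auto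
  have "(\<Sum>j<n. min C (r ^ j * (E * exp (w * N)))) \<le> (real k0 * C + E / (1 - r)) * (1 + real N)" for N n :: nat
  proof -
    define K where "K = k0 * N"
    define g where "g j = (if j < K then C else E * r ^ (j - K))" for j
    have g0: "0 \<le> g j" for j using C E r by (simp add: g_def)
    have "r ^ K * exp (w * N) \<le> 1"
    proof -
      have "r ^ K = (r ^ k0) ^ N" by (simp add: K_def power_mult)
      also have "\<dots> \<le> exp (- w) ^ N" using k0 r by (intro power_mono) auto
      also have "\<dots> = exp (- (w * N))" by (simp flip: exp_of_nat_mult add: mult.commute)
      finally have "r ^ K * exp (w * N) \<le> exp (- (w * N)) * exp (w * N)" by (intro mult_right_mono) auto
      then show ?thesis by (simp flip: exp_add)
    qed
    then have *: "r ^ j * (E * exp (w * N)) \<le> E * r ^ (j - K)" if "K \<le> j" for j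
    proof -
      have "r ^ j * (E * exp (w * N)) = (E * r ^ (j - K)) * (r ^ K * exp (w * N))"
        using that by (simp add: power_add[symmetric] mult_ac flip: mult.assoc[of "r ^ _" "r ^ _"])
      also have "\<dots> \<le> (E * r ^ (j - K)) * 1"
        using \<open>r ^ K * exp (w * N) \<le> 1\<close> E r by (intro mult_left_mono) auto
      finally show ?thesis by simp
    qed
    have "(\<Sum>j<n. min C (r ^ j * (E * exp (w * N)))) \<le> (\<Sum>j<n. g j)"
      using * by (intro sum_mono) (auto simp: g_def min_le_iff_disj)
    \<comment> \<open>Enlarging the range to \<open>K + n\<close> splits it into exactly
      \<open>K\<close> constant and \<open>n\<close> geometric terms, whether or not
      \<open>n\<close> exceeds \<open>K\<close>.\<close>
    also have "\<dots> \<le> (\<Sum>j<K + n. g j)"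
      using g0 by (intro sum_mono2) auto
    also have "\<dots> = K * C + E * (\<Sum>i<n. r ^ i)"
      by (induction n) (simp_all add: g_def algebra_simps)
    also have "(\<Sum>i<n. r ^ i) \<le> 1 / (1 - r)"
      using r by (simp add: sum_gp_strict divide_right_mono)
    also have "real K * C + E * (1 / (1 - r)) \<le> (real k0 * C + E / (1 - r)) * (1 + real N)"
    proof -
      define e where "e = E / (1 - r)"
      have "0 \<le> e" "0 \<le> e * real N" "0 \<le> real k0 * C" using C E r by (simp_all add: e_def)
      moreover have "E * (1 / (1 - r)) = e" by (simp add: e_def)
      ultimately show ?thesis unfolding K_def e_def[symmetric] by (simp add: algebra_simps)
    qed
    finally show ?thesis using E by (auto intro: mult_left_mono)
  qed
  moreover have "0 \<le> real k0 * C + E / (1 - r)" using C E r by simp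
  ultimately show ?thesis by blast
qed

context positive_potential_semigroup
begin

lemma kernel_integrable:
  assumes "continuous_on {0<..} k" "0 < a"
  shows "(\<lambda>s. k s *\<^sub>R S s y) integrable_on {a..b}"
  using assms by (intro integrable_continuous_real continuous_on_scaleR continuous_on_orbit_interval continuous_on_subset[OF assms(1)]) auto

text \<open>Between \<open>1 / 2 ^ (n + 1)\<close> and \<open>1 / 2 ^ n\<close> the kernel is
  largest for the left end point, where its bound is at most
  \<open>2 * (2 powr (- \<beta>)) ^ n * 2 ^ n\<close>. Extending the window down to 0 turns the
  factor \<open>2 ^ n\<close> into the normalisation of a mean, as in
  \<open>average_bound\<close>.\<close>

lemma kernel_integral_le_dyadic:
  assumes k: "continuous_on {0<..} k" "\<And>s. 0 < s \<Longrightarrow> k s \<le> s powr (\<beta> - 1)"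
    and \<beta>: "0 \<le> \<beta>" "\<beta> \<le> 1" and y: "0 \<le> y" and L: "1 \<le> L"
  shows "integral {1 / 2 ^ n..L} (\<lambda>s. k s *\<^sub>R S s y) \<le>
    (\<Sum>j<n. (2 * (2 powr (- \<beta>)) ^ j) *\<^sub>R ((2 ^ j) *\<^sub>R integral {0..1 / 2 ^ j} (\<lambda>s. S s y))) + integral {1..L} (\<lambda>s. S s y)"
proof (induction n)
  case 0
  have "integral {1..L} (\<lambda>s. k s *\<^sub>R S s y) \<le> integral {1..L} (\<lambda>s. S s y)"
  proof (rule integral_mono_lattice[OF kernel_integrable[OF k(1)] orbit_integrable])
    fix s assume s: "s \<in> {1..L}"
    then have "k s \<le> s powr (\<beta> - 1)" using k by auto
    also have "\<dots> \<le> s powr 0" using s \<beta> by (intro powr_mono) auto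
    finally have "k s \<le> 1" using s by simp
    then show "k s *\<^sub>R S s y \<le> S s y" using scaleR_right_mono[of "k s" 1 "S s y"] pos[of s y] y s by auto
  qed auto
  then show ?case by simp
next
  case (Suc n)
  let ?a = "1 / 2 ^ Suc n :: real" and ?b = "1 / 2 ^ n :: real" and ?c = "2 * (2 powr (- \<beta>)) ^ n * 2 ^ n"
  have "?b \<le> 1" by simp
  then have ab: "0 < ?a" "?a \<le> ?b" "?b \<le> L" using L by (simp, simp add: field_simps, linarith)
  have c: "0 \<le> ?c" by simp
  have "integral {?a..?b} (\<lambda>s. k s *\<^sub>R S s y) \<le> integral {?a..?b} (\<lambda>s. ?c *\<^sub>R S s y)"
  proof (rule integral_mono_lattice[OF kernel_integrable[OF k(1) ab(1)] integrable_cmul[OF orbit_integrable]])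
    fix s assume s: "s \<in> {?a..?b}"
    then have s0: "0 < s" using ab by (meson atLeastAtMost_iff less_le_trans)
    then have "k s \<le> s powr (\<beta> - 1)" using k by auto
    also have "\<dots> \<le> ?a powr (\<beta> - 1)" using s \<beta> ab(1) by (intro powr_mono2') auto
    also have "?a powr (\<beta> - 1) = (2 powr (- \<beta> + 1)) ^ Suc n"
    proof -
      have "?a = 2 powr (- real (Suc n))" by (simp only: powr_minus_divide powr_realpow)
      then have "?a powr (\<beta> - 1) = 2 powr (real (Suc n) * (- \<beta> + 1))"
        by (simp only: powr_powr) (simp add: algebra_simps)
      then show ?thesis by (simp only: powr_power)
    qed
    also have "2 powr (- \<beta> + 1) = 2 * 2 powr (- \<beta>)" by (subst powr_add) simp
    also have "(2 * 2 powr (- \<beta>)) ^ Suc n = ?c * 2 powr (- \<beta>)" by (simp add: power_mult_distrib)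
    also have "\<dots> \<le> ?c * 2 powr 0" using \<beta> by (intro mult_left_mono powr_mono) auto
    finally have "k s \<le> ?c" by simp
    then show "k s *\<^sub>R S s y \<le> ?c *\<^sub>R S s y" using s0 y pos[of s y] by (intro scaleR_right_mono) auto
  qed (use ab in auto)
  also have "\<dots> = ?c *\<^sub>R integral {?a..?b} (\<lambda>s. S s y)" by simp
  also have "\<dots> \<le> ?c *\<^sub>R integral {0..?b} (\<lambda>s. S s y)"
    using ab y by (intro scaleR_left_mono c integral_le_from_zero) auto
  finally have piece: "integral {?a..?b} (\<lambda>s. k s *\<^sub>R S s y) \<le> ?c *\<^sub>R integral {0..?b} (\<lambda>s. S s y)" .
  have split: "integral {?a..?b} (\<lambda>s. k s *\<^sub>R S s y) + integral {?b..L} (\<lambda>s. k s *\<^sub>R S s y)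
      = integral {?a..L} (\<lambda>s. k s *\<^sub>R S s y)"
    by (rule Henstock_Kurzweil_Integration.integral_combine[OF ab(2,3) kernel_integrable[OF k(1) ab(1)]])
  have "integral {?a..L} (\<lambda>s. k s *\<^sub>R S s y) \<le>
      ?c *\<^sub>R integral {0..?b} (\<lambda>s. S s y) + integral {?b..L} (\<lambda>s. k s *\<^sub>R S s y)"
    unfolding split[symmetric] using piece by (rule add_right_mono)
  also note add_left_mono[OF Suc, of "?c *\<^sub>R integral {0..?b} (\<lambda>s. S s y)"]
  finally show ?case by (simp add: algebra_simps)
qed

text \<open>Each dyadic mean has two bounds: a time-uniform one from \<open>average_bound\<close>,
  whose growth in \<open>j\<close> cancels against \<open>r ^ j\<close>, and one from the
  exponential growth of \<open>S\<close>, which keeps \<open>r ^ j\<close>. Their minima sum to a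
  linear function of \<open>N\<close>. The part over \<open>{1..L}\<close> lies below the potential
  \<open>u\<close>. The constant is independent of \<open>n\<close> and \<open>L\<close>, so limits
  can be taken.\<close>

lemma kernel_integral_bound:
  assumes p: "1 \<le> p" and q: "p < q"
    and cvx: "p_convex p TYPE('a)" and ccv: "q_concave q TYPE('a)"
    and k: "continuous_on {0<..} k" "\<And>s. 0 < s \<Longrightarrow> 0 \<le> k s" "\<And>s. 0 < s \<Longrightarrow> k s \<le> s powr (1 / p - 1 / q - 1)"
  shows "\<exists>A\<ge>0. \<forall>N n L y. 1 \<le> L \<longrightarrow>
    norm (S (real N + 2) (integral {1 / 2 ^ n..L} (\<lambda>s. k s *\<^sub>R S s y))) \<le> A * (1 + real N) * norm y"
proof -
  define \<beta> where "\<beta> = 1 / p - 1 / q"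
  have "1 / q < 1 / p" "1 / p \<le> 1" "0 < 1 / q" using p q by (auto simp: field_simps)
  then have \<beta>: "0 < \<beta>" "\<beta> \<le> 1" unfolding \<beta>_def by linarith+
  define r where "r = 2 powr (- \<beta>)"
  have r: "0 < r" "r < 1" using \<beta> powr_less_mono[of "- \<beta>" 0 2] by (auto simp: r_def)
  obtain C where C: "0 \<le> C" and avg: "\<And>m N y. 1 \<le> m \<Longrightarrow> 0 \<le> y \<Longrightarrow>
      norm (S (real N + 2) (real m *\<^sub>R integral {0..1/m} (\<lambda>t. S t y))) \<le> C * real m powr \<beta> * norm y"
    using average_bound[OF p _ cvx ccv] q unfolding \<beta>_def by (metis less_imp_le)
  \<comment> \<open>The factor \<open>M * exp (2 * w)\<close> covers the flow to
    \<open>N + 2\<close> apart from \<open>exp (w * N)\<close>; the factor \<open>M * exp w\<close>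
    bounds the means over windows of length at most 1.\<close>
  define E where "E = M * exp (2 * w) * (M * exp w)"
  have E: "0 \<le> E" using M by (simp add: E_def)
  obtain A where A: "0 \<le> A" "\<And>N n. (\<Sum>j<n. min C (r ^ j * (E * exp (w * real N)))) \<le> A * (1 + real N)"
    using sum_min_geometric_le_linear[OF r C E, of w] by blast
  have nonneg: "norm (S (real N + 2) (integral {1 / 2 ^ n..L} (\<lambda>s. k s *\<^sub>R S s y))) \<le> (2 * A + K) * (1 + real N) * norm y"
    if L: "1 \<le> L" and y: "0 \<le> y" for N n :: nat and L y
  proof -
    define t where "t = real N + 2"
    have t: "0 \<le> t" by (simp add: t_def)
    note linS = bounded_linear.linear[OF bounded_linear_S[OF t]]
    define D where "D j = (2 ^ j) *\<^sub>R integral {0..1 / 2 ^ j} (\<lambda>s. S s y)" for j :: nat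
    obtain u where u: "norm u \<le> K * norm y" "\<And>N. 0 \<le> N \<Longrightarrow> integral {0..N} (\<lambda>t. S t y) \<le> u"
      using potential[OF y] by blast
    have D: "r ^ j * norm (S t (D j)) \<le> min C (r ^ j * (E * exp (w * N))) * norm y" for j
    proof -
      have "norm (S t (D j)) \<le> C * (2 ^ j) powr \<beta> * norm y"
        using avg[of "2 ^ j" y N] y by (simp add: D_def t_def)
      also have "(2 ^ j) powr \<beta> = (2 powr \<beta>) ^ j"
        by (simp add: powr_power powr_powr mult.commute flip: powr_realpow)
      finally have "r ^ j * norm (S t (D j)) \<le> r ^ j * (C * (2 powr \<beta>) ^ j * norm y)"
        using r by (intro mult_left_mono) auto
      also have "\<dots> = (r * 2 powr \<beta>) ^ j * (C * norm y)" by (simp add: power_mult_distrib)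
      also have "r * 2 powr \<beta> = 1" by (simp add: r_def flip: powr_add)
      finally have 1: "r ^ j * norm (S t (D j)) \<le> C * norm y" by simp
      have "norm (integral {0..1 / 2 ^ j} (\<lambda>s. S s y)) \<le> M * exp (w * (1 / 2 ^ j)) * norm y * (1 / 2 ^ j - 0)"
        by (rule norm_integral_le) auto
      also have "\<dots> \<le> M * exp (w * 1) * norm y * (1 / 2 ^ j - 0)"
        using M by (intro mult_right_mono mult_left_mono exp_le_cancel_iff[THEN iffD2] w) auto
      finally have "norm (D j) \<le> M * exp w * norm y"
        by (simp add: D_def field_simps)
      then have "M * exp (w * t) * norm (D j) \<le> M * exp (w * t) * (M * exp w * norm y)"
        using M by (intro mult_left_mono) auto
      then have "norm (S t (D j)) \<le> M * exp (w * t) * (M * exp w * norm y)"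
        using norm_S_le[OF t, of "D j"] by linarith
      also have "exp (w * t) = exp (2 * w) * exp (w * N)"
        by (simp add: t_def algebra_simps flip: exp_add)
      finally have "norm (S t (D j)) \<le> E * exp (w * N) * norm y" by (simp add: E_def mult_ac)
      then have 2: "r ^ j * norm (S t (D j)) \<le> r ^ j * (E * exp (w * N) * norm y)"
        using r by (intro mult_left_mono) auto
      show ?thesis
        using 1 2 by (cases "C \<le> r ^ j * (E * exp (w * N))") (auto simp: min_def mult.assoc)
    qed
    have a0: "0 < 1 / (2 ^ n :: real)" by simp
    \<comment> \<open>Nonnegativity of the smaller side allows the order estimate below to pass to
      norms.\<close>
    have kernel_nonneg: "0 \<le> integral {1 / 2 ^ n..L} (\<lambda>s. k s *\<^sub>R S s y)"
    proof (rule integral_nonneg_lattice[OF kernel_integrable[OF k(1) a0]])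
      fix s assume "s \<in> {1 / 2 ^ n..L}"
      then have "0 < s" using a0 by (meson atLeastAtMost_iff less_le_trans)
      then show "0 \<le> k s *\<^sub>R S s y" using k(2) y by (intro scaleR_nonneg_nonneg pos) auto
    qed
    have "S t (integral {1 / 2 ^ n..L} (\<lambda>s. k s *\<^sub>R S s y)) \<le>
        S t ((\<Sum>j<n. (2 * r ^ j) *\<^sub>R D j) + integral {1..L} (\<lambda>s. S s y))"
      unfolding r_def D_def
      by (intro S_mono t kernel_integral_le_dyadic k y L) (use k(3) \<beta> in \<open>auto simp: \<beta>_def\<close>)
    also have "\<dots> = (\<Sum>j<n. (2 * r ^ j) *\<^sub>R S t (D j)) + integral {1 + t..L + t} (\<lambda>s. S s y)"
      using t by (simp add: linear_add[OF linS] linear_sum[OF linS] linear_scale[OF linS] S_integral)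
    also have "\<dots> \<le> (\<Sum>j<n. (2 * r ^ j) *\<^sub>R S t (D j)) + u"
      using t L y by (intro add_left_mono order_trans[OF integral_le_from_zero u(2)]) auto
    finally have "norm (S t (integral {1 / 2 ^ n..L} (\<lambda>s. k s *\<^sub>R S s y))) \<le> norm ((\<Sum>j<n. (2 * r ^ j) *\<^sub>R S t (D j)) + u)"
      by (intro lattice_norm_mono pos t kernel_nonneg)
    also have "\<dots> \<le> (\<Sum>j<n. 2 * (r ^ j * norm (S t (D j)))) + norm u"
      using r by (intro norm_triangle_le add_mono order_trans[OF norm_sum] sum_mono) auto
    also have "\<dots> \<le> (\<Sum>j<n. 2 * (min C (r ^ j * (E * exp (w * N))) * norm y)) + K * norm y"
      by (intro add_mono sum_mono mult_left_mono D u) auto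
    also have "\<dots> = 2 * (\<Sum>j<n. min C (r ^ j * (E * exp (w * N)))) * norm y + K * norm y"
      by (simp add: sum_distrib_left sum_distrib_right mult.assoc)
    also have "\<dots> \<le> 2 * (A * (1 + real N)) * norm y + K * norm y"
      by (intro add_right_mono mult_right_mono mult_left_mono A) auto
    also have "\<dots> \<le> (2 * A + K) * (1 + real N) * norm y"
      using K by (simp add: algebra_simps)
    finally show ?thesis by (simp add: t_def)
  qed
  have "norm (S (real N + 2) (integral {1 / 2 ^ n..L} (\<lambda>s. k s *\<^sub>R S s y))) \<le> 2 * (2 * A + K) * (1 + real N) * norm y"
    if L: "1 \<le> L" for N n :: nat and L y
  proof -
    have t: "0 \<le> real N + 2" by simp
    note linS = bounded_linear.linear[OF bounded_linear_S[OF t]]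
    define f where "f y = integral {1 / 2 ^ n..L} (\<lambda>s. k s *\<^sub>R S s y)" for y
    have a0: "0 < 1 / (2 ^ n :: real)" by simp
    \<comment> \<open>Positive and negative parts of \<open>y\<close> reduce the general case to the
      nonnegative one, at the cost of a factor 2.\<close>
    have "f y = integral {1 / 2 ^ n..L} (\<lambda>s. k s *\<^sub>R S s (sup y 0) - k s *\<^sub>R S s (sup (- y) 0))"
      unfolding f_def
    proof (rule integral_cong)
      fix s assume "s \<in> {1 / 2 ^ n..L}"
      then have "0 \<le> s" using a0 by (meson atLeastAtMost_iff less_imp_le order_trans)
      then have "S s y = S s (sup y 0) - S s (sup (- y) 0)"
        using pos_part_diff[of y] linear_diff[OF bounded_linear.linear[OF bounded_linear_S]] by metis
      then show "k s *\<^sub>R S s y = k s *\<^sub>R S s (sup y 0) - k s *\<^sub>R S s (sup (- y) 0)"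
        by (simp add: scaleR_right_diff_distrib)
    qed
    also have "\<dots> = f (sup y 0) - f (sup (- y) 0)"
      unfolding f_def by (intro integral_diff kernel_integrable k a0)
    finally have "S (real N + 2) (f y) = S (real N + 2) (f (sup y 0)) - S (real N + 2) (f (sup (- y) 0))"
      by (simp add: linear_diff[OF linS])
    also have "norm \<dots> \<le> (2 * A + K) * (1 + real N) * norm (sup y 0) + (2 * A + K) * (1 + real N) * norm (sup (- y) 0)"
      unfolding f_def by (intro norm_triangle_le_diff add_mono nonneg L) auto
    also have "\<dots> \<le> (2 * A + K) * (1 + real N) * norm y + (2 * A + K) * (1 + real N) * norm y"
      using norm_pos_part_le[of y] norm_pos_part_le[of "- y"] A K
      by (intro add_mono mult_left_mono) auto
    finally show ?thesis by (simp add: f_def algebra_simps)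
  qed
  then show ?thesis using A K by (intro exI[of _ "2 * (2 * A + K)"]) auto
qed

text \<open>For equal exponents the bound of \<open>average_bound\<close> does not depend on
  \<open>m\<close>, while the means converge to \<open>y\<close> as the windows shrink.\<close>

lemma orbit_bound_concave_convex:
  assumes p: "1 \<le> p" and cvx: "p_convex p TYPE('a)" and ccv: "q_concave p TYPE('a)"
  shows "\<exists>A\<ge>0. \<forall>N y. norm (S (real N + 2) y) \<le> A * norm y"
proof -
  obtain C where C: "0 \<le> C" and avg: "\<And>m N y. 1 \<le> m \<Longrightarrow> 0 \<le> y \<Longrightarrow>
      norm (S (real N + 2) (real m *\<^sub>R integral {0..1/m} (\<lambda>t. S t y))) \<le> C * real m powr (1 / p - 1 / p) * norm y"
    using average_bound[OF p order_refl cvx ccv] by metis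
  have nonneg: "norm (S (real N + 2) y) \<le> C * norm y" if y: "0 \<le> y" for N :: nat and y
  proof (rule LIMSEQ_le_const2)
    have "filterlim (\<lambda>m. 1 / real (Suc m)) (at_right 0) sequentially"
      unfolding filterlim_at
      using LIMSEQ_Suc[OF lim_1_over_n] by auto
    then have "(\<lambda>m. real (Suc m) *\<^sub>R integral {0..1 / real (Suc m)} (\<lambda>t. S t y)) \<longlonglongrightarrow> y"
      using filterlim_compose[OF average_tendsto[of y]] by fastforce
    then show "(\<lambda>m. norm (S (real N + 2) (real (Suc m) *\<^sub>R integral {0..1 / real (Suc m)} (\<lambda>t. S t y)))) \<longlonglongrightarrow> norm (S (real N + 2) y)"
      by (intro tendsto_norm bounded_linear.tendsto[OF bounded_linear_S]) auto
    show "\<exists>N'. \<forall>m\<ge>N'. norm (S (real N + 2) (real (Suc m) *\<^sub>R integral {0..1 / real (Suc m)} (\<lambda>t. S t y))) \<le> C * norm y"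
      using avg[of "Suc _" y N] y by auto
  qed
  have "norm (S (real N + 2) y) \<le> 2 * C * norm y" for N :: nat and y
  proof -
    have t: "0 \<le> real N + 2" by simp
    have "S (real N + 2) y = S (real N + 2) (sup y 0) - S (real N + 2) (sup (- y) 0)"
      using pos_part_diff[of y] linear_diff[OF bounded_linear.linear[OF bounded_linear_S[OF t]]] by metis
    also have "norm \<dots> \<le> C * norm (sup y 0) + C * norm (sup (- y) 0)"
      by (intro norm_triangle_le_diff add_mono nonneg) auto
    also have "\<dots> \<le> C * norm y + C * norm y"
      using norm_pos_part_le[of y] norm_pos_part_le[of "- y"] C
      by (intro add_mono mult_left_mono) auto
    finally show ?thesis by simp
  qed
  then show ?thesis using C by (intro exI[of _ "2 * C"]) auto
qed

text \<open>The times \<open>N + 2\<close> are less than one unit below a suitable \<open>t\<close>,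
  so the bound extends to all large \<open>t\<close>; any \<open>e > 0\<close> then beats the linear
  growth.\<close>

lemma exp_decay:
  assumes A: "\<And>N::nat. norm (S (real N + 2) x) \<le> A * (1 + real N)" and e: "0 < e"
  shows "((\<lambda>t. exp (- e * t) *\<^sub>R S t x) \<longlongrightarrow> 0) at_top"
proof (rule Lim_null_comparison)
  have A0: "0 \<le> A" using A[of 0] by (auto intro: order_trans[OF norm_ge_zero])
  show "((\<lambda>t. M * exp w * A * (t * exp (- (e * t)))) \<longlongrightarrow> 0) at_top"
  proof -
    have "((\<lambda>t. t * exp (- (e * t))) \<longlongrightarrow> 0) at_top" using e by real_asymp
    then show ?thesis by (rule tendsto_mult_right_zero)
  qed
  show "\<forall>\<^sub>F t in at_top. norm (exp (- e * t) *\<^sub>R S t x) \<le> M * exp w * A * (t * exp (- (e * t)))"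
    using eventually_ge_at_top[of 2]
  proof eventually_elim
    fix t :: real assume t: "2 \<le> t"
    define N where "N = nat \<lfloor>t - 2\<rfloor>"
    have N: "real N \<le> t - 2" "t - 2 \<le> real N + 1" using t unfolding N_def by linarith+
    have "S t x = S (t - (real N + 2)) (S (real N + 2) x)"
      using N S_add[of "t - (real N + 2)" "real N + 2" x] by simp
    also have "norm \<dots> \<le> M * exp (w * 1) * norm (S (real N + 2) x)"
      using N by (intro norm_S_le_upto) auto
    also have "\<dots> \<le> M * exp (w * 1) * (A * t)"
      using M A0 N by (intro mult_left_mono order_trans[OF A] mult_left_mono) auto
    finally have "exp (- (e * t)) * norm (S t x) \<le> exp (- (e * t)) * (M * exp (w * 1) * (A * t))"
      by (rule mult_left_mono) simp
    then show "norm (exp (- e * t) *\<^sub>R S t x) \<le> M * exp w * A * (t * exp (- (e * t)))"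
      by (simp add: mult_ac)
  qed
qed

end

section \<open>Positivity of the resolvent\<close>

text \<open>The estimates for the fractional kernel concern compact intervals away from 0. This
  limit at both ends carries them over to the integral on the half line.\<close>

lemma integral_half_line_limit:
  fixes f :: "real \<Rightarrow> 'a::banach"
  assumes f: "f integrable_on {0..}"
  shows "(\<lambda>n. integral {1 / 2 ^ n..real n} f) \<longlonglongrightarrow> integral {0..} f"
proof -
  have ii: "f integrable_on {a..b}" if "0 \<le> a" for a b
    using integrable_on_subinterval[OF f] that by auto
  have "(\<lambda>n. integral {0..real n} f) \<longlonglongrightarrow> integral {0..} f"
  proof (rule LIMSEQ_I)
    fix e :: real assume "e > 0"
    then obtain B where B: "\<And>a b. ball 0 B \<subseteq> cbox a b \<Longrightarrow>
        norm (integral (cbox a b) (\<lambda>x. if x \<in> {0..} then f x else 0) - integral {0..} f) < e"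
      using integrable_integral[OF f] unfolding has_integral_alt'[of f] by meson
    obtain n0 :: nat where n0: "B < n0" using reals_Archimedean2 by blast
    show "\<exists>no. \<forall>n\<ge>no. norm (integral {0..real n} f - integral {0..} f) < e"
    proof (intro exI[of _ n0] allI impI)
      fix n assume "n0 \<le> n"
      then have "ball 0 B \<subseteq> cbox (- real n) (real n)"
        using n0 by (auto simp: dist_real_def)
      moreover have "{0..} \<inter> cbox (- real n) (real n) = {0..real n}" by auto
      ultimately show "norm (integral {0..real n} f - integral {0..} f) < e"
        using B[of "- real n" "real n"] unfolding integral_restrict_Int by simp
    qed
  qed
  moreover have "(\<lambda>n. integral {0..1 / 2 ^ n} f) \<longlonglongrightarrow> integral {0..0} f"
  proof -
    have "continuous_on {0..1} (\<lambda>x. integral {0..x} f)"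
      by (intro indefinite_integral_continuous_1 ii) simp
    moreover have "(\<lambda>n. 1 / 2 ^ n :: real) \<longlonglongrightarrow> 0"
      using LIMSEQ_inverse_realpow_zero[of 2] by (simp add: inverse_eq_divide)
    ultimately show ?thesis
      by (rule continuous_on_tendsto_compose) auto
  qed
  ultimately have "(\<lambda>n. integral {0..real n} f - integral {0..1 / 2 ^ n} f) \<longlonglongrightarrow> integral {0..} f - integral {0..0} f"
    by (rule tendsto_diff)
  moreover have "integral {0..real n} f - integral {0..1 / 2 ^ n} f = integral {1 / 2 ^ n..real n} f" if "1 \<le> n" for n
  proof -
    have "(1 / 2 ^ n :: real) \<le> 1" by simp
    then have "(1 / 2 ^ n :: real) \<le> real n" using that by linarith
    then show ?thesis
      using Henstock_Kurzweil_Integration.integral_combine[of 0 "1 / 2 ^ n" "real n" f] ii by (simp add: algebra_simps)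
  qed
  then have "\<forall>\<^sub>F n in sequentially. integral {0..real n} f - integral {0..1 / 2 ^ n} f = integral {1 / 2 ^ n..real n} f"
    by (auto intro: eventually_sequentiallyI[of 1])
  ultimately show ?thesis by (auto dest: Lim_transform_eventually)
qed

section \<open>Generators, rescaling and the resolvent at real points\<close>

abbreviation generates :: "(real \<Rightarrow> 'a::banach \<Rightarrow> 'a) \<Rightarrow> 'a \<Rightarrow> 'a \<Rightarrow> bool" where
  "generates T u g \<equiv> ((\<lambda>h. (1 / h) *\<^sub>R (T h u - u)) \<longlongrightarrow> g) (at_right 0)"

lemma generates_iff: "generates T u g \<longleftrightarrow> u \<in> gen_dom T \<and> gen T u = g"
proof -
  have "Lim (at_right 0) (\<lambda>h. (1 / h) *\<^sub>R (T h u - u)) = y" if "generates T u y" for y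
    by (rule tendsto_Lim[OF trivial_limit_at_right_real that])
  then show ?thesis unfolding gen_dom_def gen_def by auto
qed

text \<open>The rate drops from \<open>w\<close> to \<open>w - a\<close>; the two maxima restore the
  normalisation required by the locale.\<close>

lemma rescaled_semigroup:
  fixes T :: "real \<Rightarrow> 'a::banach \<Rightarrow> 'a"
  assumes T: "c0_semigroup T" and b: "\<And>t. 0 \<le> t \<Longrightarrow> onorm (T t) \<le> M * exp (w * t)"
  shows "bounded_c0_semigroup (\<lambda>t x. exp (- a * t) *\<^sub>R T t x) (max 1 M) (max 0 (w - a))"
proof (rule bounded_c0_semigroup.intro)
  fix t s :: real and x :: 'a
  show "bounded_linear (\<lambda>x. exp (- a * t) *\<^sub>R T t x)" if "0 \<le> t"
    using T that by (intro bounded_linear_const_scaleR) (simp add: c0_semigroup_def)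
  show "exp (- a * 0) *\<^sub>R T 0 x = x" using T by (simp add: c0_semigroup_def)
  show "exp (- a * (s + t)) *\<^sub>R T (s + t) x = exp (- a * s) *\<^sub>R T s (exp (- a * t) *\<^sub>R T t x)" if st: "0 \<le> s" "0 \<le> t"
  proof -
    have "bounded_linear (T s)" "T (s + t) x = T s (T t x)" using T st by (auto simp: c0_semigroup_def)
    then show ?thesis
      by (simp add: linear_scale[OF bounded_linear.linear] algebra_simps flip: exp_add)
  qed
  have "((\<lambda>t. exp (- a * t) *\<^sub>R T t x) \<longlongrightarrow> exp (- a * 0) *\<^sub>R x) (at_right 0)"
    using T by (intro tendsto_intros) (simp add: c0_semigroup_def)
  then show "((\<lambda>t. exp (- a * t) *\<^sub>R T t x) \<longlongrightarrow> x) (at_right 0)" by simp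
  show "norm (exp (- a * t) *\<^sub>R T t x) \<le> max 1 M * exp (max 0 (w - a) * t) * norm x" if t: "0 \<le> t"
  proof -
    have "norm (T t x) \<le> onorm (T t) * norm x"
      using T t by (intro onorm) (simp add: c0_semigroup_def)
    also have "\<dots> \<le> (M * exp (w * t)) * norm x" using b[OF t] by (rule mult_right_mono) simp
    finally have "exp (- a * t) * norm (T t x) \<le> exp (- a * t) * ((M * exp (w * t)) * norm x)"
      by (rule mult_left_mono) simp
    also have "\<dots> = M * exp ((w - a) * t) * norm x"
      by (simp add: algebra_simps exp_diff exp_minus field_simps)
    also have "\<dots> \<le> max 1 M * exp (max 0 (w - a) * t) * norm x"
      using t by (intro mult_right_mono mult_mono) (auto intro: mult_right_mono)
    finally show ?thesis by simp
  qed
qed simp_all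

lemma generates_rescaled:
  assumes T: "c0_semigroup T" and u: "generates T u g"
  shows "generates (\<lambda>t x. exp (- a * t) *\<^sub>R T t x) u (g - a *\<^sub>R u)"
proof -
  have "((\<lambda>h::real. exp (- a * h)) \<longlongrightarrow> exp (- a * 0)) (at_right 0)" by (intro tendsto_intros)
  moreover have "((\<lambda>h::real. (exp (- a * h) - 1) / h) \<longlongrightarrow> - a) (at_right 0)"
    by real_asymp
  ultimately have "((\<lambda>h. exp (- a * h) *\<^sub>R ((1 / h) *\<^sub>R (T h u - u)) + ((exp (- a * h) - 1) / h) *\<^sub>R u)
      \<longlongrightarrow> exp (- a * 0) *\<^sub>R g + (- a) *\<^sub>R u) (at_right 0)"
    by (intro tendsto_intros u)
  moreover have "exp (- a * h) *\<^sub>R ((1 / h) *\<^sub>R (T h u - u)) + ((exp (- a * h) - 1) / h) *\<^sub>R u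
      = (1 / h) *\<^sub>R (exp (- a * h) *\<^sub>R T h u - u)" for h
    by (simp add: algebra_simps diff_divide_distrib)
  ultimately show ?thesis by simp
qed

lemma generates_linear_combination:
  assumes T: "c0_semigroup T" and "generates T u g" "generates T v k"
  shows "generates T (c *\<^sub>R u + d *\<^sub>R v) (c *\<^sub>R g + d *\<^sub>R k)"
proof (rule Lim_transform_eventually)
  show "((\<lambda>h. c *\<^sub>R ((1 / h) *\<^sub>R (T h u - u)) + d *\<^sub>R ((1 / h) *\<^sub>R (T h v - v))) \<longlongrightarrow> c *\<^sub>R g + d *\<^sub>R k) (at_right 0)"
    by (intro tendsto_intros assms)
  have "c *\<^sub>R ((1 / h) *\<^sub>R (T h u - u)) + d *\<^sub>R ((1 / h) *\<^sub>R (T h v - v)) =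
      (1 / h) *\<^sub>R (T h (c *\<^sub>R u + d *\<^sub>R v) - (c *\<^sub>R u + d *\<^sub>R v))" if "0 < h" for h
  proof -
    have "linear (T h)" using T that by (simp add: c0_semigroup_def bounded_linear.linear)
    then show ?thesis by (simp add: linear_add linear_scale algebra_simps)
  qed
  then show "\<forall>\<^sub>F h in at_right 0. c *\<^sub>R ((1 / h) *\<^sub>R (T h u - u)) + d *\<^sub>R ((1 / h) *\<^sub>R (T h v - v)) =
      (1 / h) *\<^sub>R (T h (c *\<^sub>R u + d *\<^sub>R v) - (c *\<^sub>R u + d *\<^sub>R v))"
    by (auto simp: eventually_at_right_field intro: exI[of _ 1])
qed

text \<open>At a real point the two components of the complexified equation decouple. Surjectivity
  is used for the right-hand side \<open>(x, 0)\<close>, injectivity for pairs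
  \<open>(u, u)\<close>, and the norm bound with second component 0.\<close>

lemma resolvent_exists:
  assumes T: "c0_semigroup T" and a: "in_resolvent T a 0"
  shows "\<exists>R. bounded_linear R \<and> (\<forall>x u. generates T u (a *\<^sub>R u - x) \<longleftrightarrow> u = R x)"
proof -
  define f where "f = (\<lambda>(x, y). (a *\<^sub>R x - gen T x - 0 *\<^sub>R y, 0 *\<^sub>R x + a *\<^sub>R y - gen T y))"
  have bij: "bij_betw f (gen_dom T \<times> gen_dom T) UNIV"
    using a unfolding in_resolvent_def f_def by blast
  obtain C where C: "\<And>x y. x \<in> gen_dom T \<Longrightarrow> y \<in> gen_dom T \<Longrightarrow>
      norm x + norm y \<le> C * (norm (a *\<^sub>R x - gen T x - 0 *\<^sub>R y) + norm (0 *\<^sub>R x + a *\<^sub>R y - gen T y))"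
    using a unfolding in_resolvent_def by blast
  have zero: "generates T 0 0"
  proof -
    have "T h 0 = 0" if "0 < h" for h
      using T that by (simp add: c0_semigroup_def linear_0 bounded_linear.linear)
    then have "\<forall>\<^sub>F h in at_right 0. 0 = (1 / h) *\<^sub>R (T h 0 - 0)"
      by (auto simp: eventually_at_right_field intro: exI[of _ 1])
    then show ?thesis by (rule Lim_transform_eventually[OF tendsto_const])
  qed
  have ex: "\<exists>u. generates T u (a *\<^sub>R u - x)" for x
  proof -
    obtain u v where "u \<in> gen_dom T" "f (u, v) = (x, 0)"
    proof -
      have "(x, 0) \<in> f ` (gen_dom T \<times> gen_dom T)" by (simp add: bij_betw_imp_surj_on[OF bij])
      then show ?thesis using that by auto
    qed
    then show ?thesis unfolding generates_iff by (auto simp: f_def)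
  qed
  have uniq: "u = v" if "generates T u (a *\<^sub>R u - x)" "generates T v (a *\<^sub>R v - x)" for u v x
  proof -
    have "f (u, u) = f (v, v)" "u \<in> gen_dom T" "v \<in> gen_dom T"
      using that unfolding generates_iff by (auto simp: f_def)
    then show ?thesis using bij_betw_imp_inj_on[OF bij] by (auto dest: inj_onD)
  qed
  define R where "R x = (SOME u. generates T u (a *\<^sub>R u - x))" for x
  have R: "generates T (R x) (a *\<^sub>R R x - x)" for x
    unfolding R_def by (rule someI_ex[OF ex])
  have R_eq: "R x = u" if "generates T u (a *\<^sub>R u - x)" for x u using uniq[OF R that] .
  have "bounded_linear R"
  proof (rule bounded_linear_intro)
    show "R (x + y) = R x + R y" for x y
      using generates_linear_combination[OF T R[of x] R[of y], of 1 1]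
      by (intro R_eq) (simp add: algebra_simps)
    show "R (c *\<^sub>R x) = c *\<^sub>R R x" for c x
      using generates_linear_combination[OF T R[of x] zero, of c 0]
      by (intro R_eq) (simp add: algebra_simps)
    show "norm (R x) \<le> norm x * C" for x
      using C[of "R x" 0] R[of x] zero unfolding generates_iff by (simp add: algebra_simps)
  qed
  moreover have "generates T u (a *\<^sub>R u - x) \<longleftrightarrow> u = R x" for x u
    using R[of x] R_eq[of u x] by auto
  ultimately show ?thesis by blast
qed

text \<open>The negative part \<open>v\<close> of \<open>R' x\<close> satisfies \<open>v \<le> d R v\<close>, and \<open>d R\<close> is a strict contraction.\<close>
lemma resolvent_positive_step:
  fixes R R' :: "'a::banach_lattice \<Rightarrow> 'a"
  assumes lin: "linear R" and pos: "\<And>x. 0 \<le> x \<Longrightarrow> 0 \<le> R x" and B: "\<And>x. norm (R x) \<le> B * norm x"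
    and d: "0 \<le> d" "d * B < 1" and R': "\<And>x. R' x = R (x + d *\<^sub>R R' x)" and x: "0 \<le> x"
  shows "0 \<le> R' x"
proof -
  define u where "u = R' x"
  define v where "v = sup (- u) 0"
  have v0: "0 \<le> v" "- u \<le> v" by (simp_all add: v_def)
  have u: "u = R x + d *\<^sub>R R u" using R'[of x] by (simp add: u_def linear_add[OF lin] linear_scale[OF lin])
  have "0 \<le> R (v + u)" using v0 by (intro pos) (metis add.commute add.right_inverse add_left_mono)
  then have "- R u \<le> R v" by (simp add: linear_add[OF lin] minus_le_iff le_minus_iff)
      (metis add.commute add_increasing2 diff_ge_0_iff_ge diff_minus_eq_add order_refl minus_le_iff)
  then have "d *\<^sub>R (- R u) \<le> d *\<^sub>R R v" using d by (intro scaleR_left_mono)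
  moreover have "- u \<le> d *\<^sub>R (- R u)" using pos[OF x] by (subst u) simp
  ultimately have "- u \<le> d *\<^sub>R R v" by (meson order_trans)
  moreover have "0 \<le> d *\<^sub>R R v" using d v0 by (intro scaleR_nonneg_nonneg pos)
  ultimately have "v \<le> d *\<^sub>R R v" by (simp add: v_def)
  then have "norm v \<le> d * norm (R v)" using lattice_norm_mono[OF v0(1)] d by fastforce
  also have "\<dots> \<le> d * (B * norm v)" using d B by (intro mult_left_mono)
  finally have "(1 - d * B) * norm v \<le> 0" by (simp add: algebra_simps)
  then have "norm v \<le> 0" using d by (simp add: mult_le_0_iff)
  then have "v = 0" by simp
  then have "- u \<le> 0" using v0(2) by simp
  then show ?thesis by (simp add: u_def)
qed

text \<open>A continuation argument: let \<open>c\<close> be the supremum of the points from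
  \<open>a\<close> on at which positivity fails. Just above \<open>c\<close> positivity holds, and
  \<open>resolvent_positive_step\<close> carries it from there to all such points close below
  \<open>c\<close>, a contradiction.\<close>

lemma resolvent_positive:
  fixes R :: "real \<Rightarrow> 'a::banach_lattice \<Rightarrow> 'a"
  assumes up: "\<And>a b. Q a \<Longrightarrow> a \<le> b \<Longrightarrow> Q b"
    and bl: "\<And>a. Q a \<Longrightarrow> bounded_linear (R a)"
    and ident: "\<And>a b x. Q a \<Longrightarrow> Q b \<Longrightarrow> R a x = R b (x + (b - a) *\<^sub>R R a x)"
    and large: "\<And>a x. Q a \<Longrightarrow> w < a \<Longrightarrow> 0 \<le> x \<Longrightarrow> 0 \<le> R a x"
    and a: "Q a" and x: "0 \<le> x"
  shows "0 \<le> R a x"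
proof (rule ccontr)
  assume neg: "\<not> 0 \<le> R a x"
  define Z where "Z = {l. a \<le> l \<and> (\<exists>x\<ge>0. \<not> 0 \<le> R l x)}"
  have aZ: "a \<in> Z" using neg x by (auto simp: Z_def)
  have "l \<le> w" if "l \<in> Z" for l
    using that large[of l] up[OF a] by (force simp: Z_def)
  then have bdd: "bdd_above Z" by (rule bdd_aboveI)
  define c where "c = Sup Z"
  have ac: "a \<le> c" unfolding c_def by (rule cSup_upper[OF aZ bdd])
  then have Qc: "Q c" using up a by blast
  obtain B where B: "0 < B" "\<And>x. norm (R c x) \<le> B * norm x"
    using bounded_linear.pos_bounded[OF bl[OF Qc]] by (auto simp: mult.commute)
  \<comment> \<open>With this step the resolvent at \<open>c + d\<close> has norm at most
    \<open>8 / 7 * B\<close>, and a descent of at most \<open>2 * d\<close> against the cruder bound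
    \<open>2 * B\<close> gives the contraction factor \<open>1 / 2\<close>.\<close>
  define d where "d = 1 / (8 * B)"
  have d: "0 < d" "d * B = 1 / 8" using B by (auto simp: d_def)
  have Qm: "Q (c + d)" using up[OF Qc] d by simp
  have "c + d \<notin> Z" using cSup_upper[OF _ bdd, of "c + d"] d by (auto simp: c_def)
  then have pos: "0 \<le> R (c + d) x" if "0 \<le> x" for x using that ac d by (auto simp: Z_def)
  \<comment> \<open>The resolvent identity expresses the unknown at \<open>c + d\<close> through
    \<open>R c\<close>, and its own contribution is absorbed since
    \<open>d * B = 1 / 8\<close>.\<close>
  have Bm: "norm (R (c + d) x) \<le> 2 * B * norm x" for x
  proof -
    have "R (c + d) x = R c (x + (- d) *\<^sub>R R (c + d) x)" using ident[OF Qm Qc, of x] by simp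
    then have "norm (R (c + d) x) \<le> B * norm (x + (- d) *\<^sub>R R (c + d) x)" using B(2) by metis
    also have "\<dots> \<le> B * (norm x + d * norm (R (c + d) x))"
      using B d by (intro mult_left_mono order_trans[OF norm_triangle_ineq]) auto
    also have "\<dots> = B * norm x + (d * B) * norm (R (c + d) x)" by (simp add: algebra_simps)
    finally have "7 * norm (R (c + d) x) \<le> 8 * (B * norm x)" using d by simp
    moreover have "0 \<le> B * norm x" using B by simp
    ultimately show ?thesis by (simp add: mult.assoc)
  qed
  obtain l where l: "l \<in> Z" "c - d < l" using less_cSupE[of "c - d" Z] aZ d by (auto simp: c_def)
  have lc: "l \<le> c" unfolding c_def by (rule cSup_upper[OF l(1) bdd])
  have Ql: "Q l" using l up[OF a] by (auto simp: Z_def)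
  have "0 \<le> R l x" if x: "0 \<le> x" for x
  proof (rule resolvent_positive_step[of "R (c + d)" "2 * B" "c + d - l" "R l"])
    have "(c + d - l) * (2 * B) \<le> (2 * d) * (2 * B)" using l B by (intro mult_right_mono) auto
    also have "\<dots> = 4 * (d * B)" by simp
    finally show "(c + d - l) * (2 * B) < 1" using d(2) by simp
  qed (use pos Bm ident[OF Ql Qm] x lc d bounded_linear.linear[OF bl[OF Qm]] in auto)
  then show False using l by (auto simp: Z_def)
qed

section \<open>Domination of truncated orbit integrals by the resolvent\<close>

lemma spectral_bound_less_imp_in_resolvent:
  assumes "spectral_bound T < ereal a"
  shows "in_resolvent T a b"
proof (rule ccontr)
  assume "\<not> in_resolvent T a b"
  then have "ereal a \<le> spectral_bound T"
    unfolding spectral_bound_def by (intro Sup_upper) auto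
  with assms show False by simp
qed

lemma integral_rescaled_eq:
  fixes T :: "real \<Rightarrow> 'a::banach \<Rightarrow> 'a"
  assumes T: "c0_semigroup T" and b: "\<And>t. 0 \<le> t \<Longrightarrow> onorm (T t) \<le> M * exp (w * t)"
    and u: "generates T u (a *\<^sub>R u - x)" and N: "0 \<le> N"
  shows "integral {0..N} (\<lambda>t. exp (- a * t) *\<^sub>R T t x) = u - exp (- a * N) *\<^sub>R T N u"
proof -
  interpret bounded_c0_semigroup "\<lambda>t x. exp (- a * t) *\<^sub>R T t x" "max 1 M" "max 0 (w - a)"
    by (rule rescaled_semigroup[OF T b])
  have "generates (\<lambda>t x. exp (- a * t) *\<^sub>R T t x) u (- x)"
    using generates_rescaled[OF T u, of a] by simp
  then have "integral {0..N} (\<lambda>t. exp (- a * t) *\<^sub>R T t (- x)) = exp (- a * N) *\<^sub>R T N u - u"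
    using N by (rule integral_generator)
  then show ?thesis
    using linear_neg[OF linear_integral[of 0 N], of x] by (metis minus_diff_eq order_refl minus_minus)
qed

lemma orbit_tendsto_zero_above_growth:
  assumes T: "c0_semigroup T" and b: "\<And>t. 0 \<le> t \<Longrightarrow> onorm (T t) \<le> M * exp (w * t)" and "w < a"
  shows "((\<lambda>t. exp (- a * t) *\<^sub>R T t x) \<longlongrightarrow> 0) at_top"
proof (rule Lim_null_comparison)
  have "((\<lambda>t. exp ((w - a) * t)) \<longlongrightarrow> 0) at_top" using \<open>w < a\<close> by real_asymp
  then show "((\<lambda>t. M * norm x * exp ((w - a) * t)) \<longlongrightarrow> 0) at_top"
    by (rule tendsto_mult_right_zero)
  show "\<forall>\<^sub>F t in at_top. norm (exp (- a * t) *\<^sub>R T t x) \<le> M * norm x * exp ((w - a) * t)"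
    using eventually_ge_at_top[of 0]
  proof eventually_elim
    fix t :: real assume t: "0 \<le> t"
    have "norm (T t x) \<le> onorm (T t) * norm x"
      using T t by (intro onorm) (simp add: c0_semigroup_def)
    also have "\<dots> \<le> (M * exp (w * t)) * norm x" using b[OF t] by (rule mult_right_mono) simp
    finally have "exp (- a * t) * norm (T t x) \<le> exp (- a * t) * ((M * exp (w * t)) * norm x)"
      by (rule mult_left_mono) simp
    also have "\<dots> = M * norm x * exp ((w - a) * t)"
      by (simp add: algebra_simps exp_diff exp_minus field_simps)
    finally show "norm (exp (- a * t) *\<^sub>R T t x) \<le> M * norm x * exp ((w - a) * t)" by simp
  qed
qed

text \<open>The truncated integral equals \<open>R a x\<close> minus the rescaled orbit of
  \<open>R a x\<close> at time \<open>N\<close>. Once \<open>R a x \<ge> 0\<close> is known, the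
  subtracted term may be dropped. Positivity is first obtained above the growth rate
  \<open>w\<close>, then brought down to \<open>a\<close> by
  \<open>resolvent_positive\<close>.\<close>

lemma resolvent_dominates_integral:
  fixes T :: "real \<Rightarrow> 'a::banach_lattice \<Rightarrow> 'a"
  assumes T: "c0_semigroup T" and P: "positive_semigroup T"
    and b: "\<And>t. 0 \<le> t \<Longrightarrow> onorm (T t) \<le> M * exp (w * t)" and a: "spectral_bound T < ereal a"
  shows "\<exists>K\<ge>0. \<forall>x\<ge>0. \<exists>u. norm u \<le> K * norm x \<and> (\<forall>N\<ge>0. integral {0..N} (\<lambda>t. exp (- a * t) *\<^sub>R T t x) \<le> u)"
proof -
  define Q where "Q a \<longleftrightarrow> spectral_bound T < ereal a" for a
  define R where "R a = (SOME R. bounded_linear R \<and> (\<forall>x u. generates T u (a *\<^sub>R u - x) \<longleftrightarrow> u = R x))" for a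
  have RR: "bounded_linear (R a) \<and> (\<forall>x u. generates T u (a *\<^sub>R u - x) \<longleftrightarrow> u = R a x)" if "Q a" for a
    unfolding R_def
    by (rule someI_ex[OF resolvent_exists[OF T spectral_bound_less_imp_in_resolvent]]) (use that in \<open>simp add: Q_def\<close>)
  have bl: "bounded_linear (R a)" if "Q a" for a using RR[OF that] by blast
  have gen: "generates T u (a *\<^sub>R u - x) \<longleftrightarrow> u = R a x" if "Q a" for a x u using RR[OF that] by blast
  have posT: "0 \<le> exp (- a * t) *\<^sub>R T t x" if "0 \<le> t" "0 \<le> x" for a t x
    using P that by (simp add: positive_semigroup_def scaleR_nonneg_nonneg)
  \<comment> \<open>This uses only positivity of the orbit of \<open>x\<close>, not of
    \<open>R a x\<close>, so it can serve to prove the latter: for \<open>a > w\<close> the left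
    side tends to 0.\<close>
  have le: "exp (- a * N) *\<^sub>R T N (R a x) \<le> R a x" if "Q a" "0 \<le> x" "0 \<le> N" for a x N
  proof -
    interpret bounded_c0_semigroup "\<lambda>t x. exp (- a * t) *\<^sub>R T t x" "max 1 M" "max 0 (w - a)"
      by (rule rescaled_semigroup[OF T b])
    have "0 \<le> integral {0..N} (\<lambda>t. exp (- a * t) *\<^sub>R T t x)"
      using that posT by (intro integral_nonneg_lattice orbit_integrable) auto
    then show ?thesis
      using integral_rescaled_eq[OF T b gen[OF that(1), THEN iffD2, OF refl] that(3)] by simp
  qed
  have posR: "0 \<le> R a x" if Qa: "Q a" and x: "0 \<le> x" for a x
  proof (rule resolvent_positive[where Q = Q and w = w and R = R])
    show "Q b" if "Q a" "a \<le> b" for a b using that unfolding Q_def by (meson ereal_less_eq(3) less_le_trans)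
    show "bounded_linear (R a)" if "Q a" for a by (rule bl[OF that])
    show "R a x = R b (x + (b - a) *\<^sub>R R a x)" if "Q a" "Q b" for a b x
    proof -
      have "generates T (R a x) (a *\<^sub>R R a x - x)" using gen[OF \<open>Q a\<close>] by blast
      moreover have "a *\<^sub>R R a x - x = b *\<^sub>R R a x - (x + (b - a) *\<^sub>R R a x)" by (simp add: algebra_simps)
      ultimately show ?thesis using gen[OF \<open>Q b\<close>, of "R a x" "x + (b - a) *\<^sub>R R a x"] by simp
    qed
    show "0 \<le> R a x" if "Q a" "w < a" "0 \<le> x" for a x
    proof (rule tendsto_le_lattice[OF trivial_limit_at_top_linorder _ tendsto_const])
      show "((\<lambda>t. exp (- a * t) *\<^sub>R T t (R a x)) \<longlongrightarrow> 0) at_top"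
        by (rule orbit_tendsto_zero_above_growth[OF T b that(2)])
      show "\<forall>\<^sub>F N in at_top. exp (- a * N) *\<^sub>R T N (R a x) \<le> R a x"
        using eventually_ge_at_top[of 0] by eventually_elim (rule le[OF that(1,3)])
    qed
  qed (use Qa x in auto)
  have Qa: "Q a" using a by (simp add: Q_def)
  obtain K where K: "0 < K" "\<And>x. norm (R a x) \<le> norm x * K"
    using bounded_linear.pos_bounded[OF bl[OF Qa]] by blast
  have "integral {0..N} (\<lambda>t. exp (- a * t) *\<^sub>R T t x) \<le> R a x" if "0 \<le> x" "0 \<le> N" for x N
    using integral_rescaled_eq[OF T b gen[OF Qa, THEN iffD2, OF refl] that(2), of x] posT[OF that(2) posR[OF Qa that(1)], of a]
    by simp
  then show ?thesis using K by (intro exI[of _ K]) (auto simp: mult.commute)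
qed

theorem theorem5p8:
  fixes T :: "real \<Rightarrow> 'a::banach_lattice \<Rightarrow> 'a" and p q \<eta> :: real
  assumes "c0_semigroup T"
    and "positive_semigroup T"
    and "1 \<le> p" and "p \<le> q"
    and "p_convex p TYPE('a)"
    and "q_concave q TYPE('a)"
    and "growth_bound T < ereal \<eta>"
  shows "omega_beta T \<eta> (1 / p - 1 / q) \<le> spectral_bound T"
proof -
  define \<beta> where "\<beta> = 1 / p - 1 / q"
  obtain w0 M0 where w0: "w0 < \<eta>" and b: "\<And>t. 0 \<le> t \<Longrightarrow> onorm (T t) \<le> M0 * exp (w0 * t)"
    using assms(7) unfolding growth_bound_def Inf_less_iff by auto
  have decay: "((\<lambda>t. exp (- b * t) *\<^sub>R T t x) \<longlongrightarrow> 0) at_top"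
    if sb: "spectral_bound T < ereal b" and x: "x \<in> frac_dom T \<eta> \<beta>" for b x
  proof -
    \<comment> \<open>The gap \<open>b - a\<close> is reserved for absorbing the linear growth at
      the end.\<close>
    obtain a where a: "spectral_bound T < ereal a" "a < b"
      using ereal_dense2[OF sb] by auto
    show ?thesis
    proof (cases "w0 < b")
      case True
      show ?thesis by (rule orbit_tendsto_zero_above_growth[OF assms(1) b True])
    next
      case False
      \<comment> \<open>Here \<open>b \<le> w0 < \<eta>\<close>, which makes the factor
        \<open>exp (- (\<eta> - a) * s)\<close> of the kernel at most 1.\<close>
      then have a\<eta>: "a < \<eta>" using a w0 by simp
      define S where "S = (\<lambda>t x. exp (- a * t) *\<^sub>R T t x)"
      obtain K where K: "0 \<le> K" "\<And>x. 0 \<le> x \<Longrightarrow> \<exists>u. norm u \<le> K * norm x \<and> (\<forall>N\<ge>0. integral {0..N} (\<lambda>t. S t x) \<le> u)"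
        using resolvent_dominates_integral[OF assms(1,2) b a(1)] unfolding S_def by blast
      interpret bounded_c0_semigroup S "max 1 M0" "max 0 (w0 - a)"
        unfolding S_def by (rule rescaled_semigroup[OF assms(1) b])
      interpret positive_potential_semigroup S "max 1 M0" "max 0 (w0 - a)" K
        by unfold_locales
          (use assms(2) K in \<open>auto simp: S_def positive_semigroup_def scaleR_nonneg_nonneg\<close>)
      have "\<exists>A. \<forall>N::nat. norm (S (real N + 2) x) \<le> A * (1 + real N)"
      proof (cases "p = q")
        case True
        obtain A where A: "0 \<le> A" "\<And>N. norm (S (real N + 2) x) \<le> A * norm x"
          using orbit_bound_concave_convex assms True by blast
        have "A * norm x \<le> A * norm x * (1 + real N)" for N :: nat
          using A(1) by (simp add: algebra_simps)
        then show ?thesis using A(2) order_trans by blast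
      next
        case False
        then have pq: "p < q" using assms by simp
        then have "\<beta> \<noteq> 0" using assms(3) by (simp add: \<beta>_def)
        define f where "f y = (\<lambda>t. (t powr (\<beta> - 1) * exp (- \<eta> * t)) *\<^sub>R T t y)" for y
        obtain y where y: "x = (1 / Gamma \<beta>) *\<^sub>R integral {0..} (f y)"
          using x \<open>\<beta> \<noteq> 0\<close> by (auto simp: frac_dom_def f_def)
        \<comment> \<open>The kernel of the fractional power relative to \<open>S\<close>: passing
          from \<open>T\<close> to \<open>S\<close> moves \<open>exp (a * s)\<close> into
          it.\<close>
        define k where "k s = s powr (\<beta> - 1) * exp (- (\<eta> - a) * s)" for s
        have fk: "f y = (\<lambda>s. k s *\<^sub>R S s y)"
          by (simp add: fun_eq_iff f_def k_def S_def mult.assoc algebra_simps flip: exp_add)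
        have "continuous_on {0<..} k" unfolding k_def by (intro continuous_intros) auto
        moreover have "0 \<le> k s" "k s \<le> s powr (1 / p - 1 / q - 1)" if "0 < s" for s
          using a\<eta> that unfolding k_def \<beta>_def by (auto intro!: mult_left_le mult_nonpos_nonneg)
        ultimately obtain A where A: "0 \<le> A" "\<And>N n L y. 1 \<le> L \<Longrightarrow>
            norm (S (real N + 2) (integral {1 / 2 ^ n..L} (\<lambda>s. k s *\<^sub>R S s y))) \<le> A * (1 + real N) * norm y"
          using kernel_integral_bound[OF assms(3) pq assms(5,6), of k] by blast
        have "norm (S (real N + 2) (integral {0..} (f y))) \<le> A * (1 + real N) * norm y" for N :: nat
        proof (cases "f y integrable_on {0..}")
          case True
          \<comment> \<open>The uniform bound requires an upper limit of at least 1, hence holds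
            along this sequence from \<open>n = 1\<close> on.\<close>
          have "(\<lambda>n. norm (S (real N + 2) (integral {1 / 2 ^ n..real n} (f y)))) \<longlonglongrightarrow> norm (S (real N + 2) (integral {0..} (f y)))"
            by (intro tendsto_norm bounded_linear.tendsto[OF bounded_linear_S] integral_half_line_limit True) simp
          then show ?thesis
            by (rule LIMSEQ_le_const2) (auto simp: fk intro!: exI[of _ 1] A(2))
        next
          case False
          \<comment> \<open>A nonintegrable function has \<open>integral\<close> 0 by convention, so
            the estimate is trivial in this case.\<close>
          then have "integral {0..} (f y) = 0" by (rule not_integrable_integral)
          then show ?thesis using A(1) bounded_linear_S[of "real N + 2"] by (simp add: linear_0 bounded_linear.linear)
        qed
        then have "\<bar>1 / Gamma \<beta>\<bar> * norm (S (real N + 2) (integral {0..} (f y))) \<le> \<bar>1 / Gamma \<beta>\<bar> * (A * (1 + real N) * norm y)" for N :: nat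
          by (rule mult_left_mono) simp
        moreover have "norm (S (real N + 2) x) = \<bar>1 / Gamma \<beta>\<bar> * norm (S (real N + 2) (integral {0..} (f y)))" for N :: nat
          unfolding y by (subst linear_scale[OF bounded_linear.linear[OF bounded_linear_S]]) simp_all
        ultimately have "norm (S (real N + 2) x) \<le> (\<bar>1 / Gamma \<beta>\<bar> * A * norm y) * (1 + real N)" for N :: nat
          by (simp add: mult_ac)
        then show ?thesis by blast
      qed
      then obtain A where "\<And>N::nat. norm (S (real N + 2) x) \<le> A * (1 + real N)" by blast
      then have "((\<lambda>t. exp (- (b - a) * t) *\<^sub>R S t x) \<longlongrightarrow> 0) at_top"
        using a by (intro exp_decay) auto
      moreover have "exp (- (b - a) * t) *\<^sub>R S t x = exp (- b * t) *\<^sub>R T t x" for t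
        by (simp add: S_def algebra_simps flip: exp_add)
      ultimately show ?thesis by simp
    qed
  qed
  have "orbit_bound T x \<le> spectral_bound T" if x: "x \<in> frac_dom T \<eta> \<beta>" for x
  \<comment> \<open>Comparison with every larger extended real also covers an empty spectrum, where
    the right-hand side is minus infinity.\<close>
  proof (rule dense_ge)
    fix c assume "spectral_bound T < c"
    then obtain b where b: "spectral_bound T < ereal b" "ereal b < c" using ereal_dense2 by blast
    have "orbit_bound T x \<le> ereal b"
      unfolding orbit_bound_def using decay[OF b(1) x] by (intro Inf_lower) auto
    with b show "orbit_bound T x \<le> c" by simp
  qed
  then show ?thesis unfolding omega_beta_def \<beta>_def by (auto intro: SUP_least)
qed

end
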